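(* Let $n\ge0$ and let $(\gamma_\alpha)_{\alpha}$ be a family of nonnegative real numbers indexed by the compositions $\alpha$ of $n$. Let $\mathbb{k}$ be an ordered commutative ring containing the numbers $\gamma_\alpha$ (e.g. $\mathbb{k}=\mathbb{R}$). Put $B_\gamma=\sum_\alpha\gamma_\alpha B_\alpha\in\mathbb{k}S_n$ and, for $F\in\Sigma_n$, $\widetilde{n}_\gamma(F)=\sum_\alpha\gamma_\alpha\widetilde{n}_\alpha(F)\in\mathbb{k}$, and $\widetilde{n}_\gamma(\Sigma_n)=\{\widetilde{n}_\gamma(F):F\in\Sigma_n\}$. Then \[ \prod_{k\in\widetilde{n}_\gamma(\Sigma_n)}(w_0B_\gamma-k)=0\qquad\text{and}\qquad\prod_{k\in\widetilde{n}_\gamma(\Sigma_n)}(B_\gamma w_0-k)=0, \] the products ranging over distinct elements of $\widetilde{n}_\gamma(\Sigma_n)$.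
   Context: $[n]=\{1,\ldots,n\}$; $S_n$ the symmetric group with $(\sigma\tau)(i)=\sigma(\tau(i))$, $\mathbb{k}S_n$ its group algebra, $w_0(i)=n+1-i$. For a composition $\alpha=(\alpha_1,\ldots,\alpha_k)$ of $n$ (positive integers summing to $n$) let $D(\alpha)=\{\alpha_1,\ldots,\alpha_1+\cdots+\alpha_{k-1}\}$ and $B_\alpha=\sum_{w\in S_n:\operatorname{Des}w\subseteq D(\alpha)}w$, where $\operatorname{Des}w=\{i\in[n-1]:w(i)>w(i+1)\}$. A set composition of $[n]$ is a tuple $F=(F_1,\ldots,F_m)$ of nonempty pairwise disjoint sets with union $[n]$; $\ell(F)=m$, $\operatorname{type}F=(|F_1|,\ldots,|F_m|)$; $\Sigma_n$ is the set of all of them. $F\preceq G$ means each block of $F$ lies in some block of $G$. $n_\alpha(F)=\#\{G\in\Sigma_n:F\preceq G,\ \operatorname{type}G=\alpha\}$ and $\widetilde{n}_\alpha(F)=(-1)^{n-\ell(F)}n_\alpha(F)$. *)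

theory Defs
  imports Complex_Main "HOL-Algebra.Sym_Groups" "HOL-Algebra.Ring"
begin

text \<open>
  The group algebra \<open>k S\<^sub>n\<close> of the symmetric group. An element is its coefficient function
  \<open>w \<mapsto> [w] f\<close>, which vanishes off \<open>S\<^sub>n\<close>; the product is convolution.
\<close>

definition sym_group_algebra :: "nat \<Rightarrow> ((nat \<Rightarrow> nat) \<Rightarrow> 'k::comm_ring_1) ring" where
  "sym_group_algebra n =
     \<lparr> carrier = {f. \<forall>w. w \<notin> carrier (sym_group n) \<longrightarrow> f w = 0},
       mult = (\<lambda>f g w. \<Sum>(u, v) \<in> {(u, v). u \<in> carrier (sym_group n) \<and> v \<in> carrier (sym_group n)
                                            \<and> u \<otimes>\<^bsub>sym_group n\<^esub> v = w}. f u * g v),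
       one = (\<lambda>w. if w = \<one>\<^bsub>sym_group n\<^esub> then 1 else 0),
       zero = (\<lambda>_. 0),
       add = (\<lambda>f g w. f w + g w) \<rparr>"

definition basis_elt :: "(nat \<Rightarrow> nat) \<Rightarrow> (nat \<Rightarrow> nat) \<Rightarrow> 'k::comm_ring_1" where
  "basis_elt u = (\<lambda>w. if w = u then 1 else 0)"

definition scalar_elt :: "nat \<Rightarrow> 'k \<Rightarrow> (nat \<Rightarrow> nat) \<Rightarrow> 'k::comm_ring_1" where
  "scalar_elt n c = (\<lambda>w. c * \<one>\<^bsub>sym_group_algebra n\<^esub> w)"

definition list_prod :: "('a, 'b) monoid_scheme \<Rightarrow> 'a list \<Rightarrow> 'a" where
  "list_prod M xs = foldr (mult M) xs \<one>\<^bsub>M\<^esub>"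

text \<open>Extended by the identity outside \<open>{1..n}\<close>, as \<open>permutes\<close> requires.\<close>

definition longest_perm :: "nat \<Rightarrow> nat \<Rightarrow> nat" where
  "longest_perm n i = (if i \<in> {1..n} then n + 1 - i else i)"

definition compositions :: "nat \<Rightarrow> nat list set" where
  "compositions n = {\<alpha>. (\<forall>a\<in>set \<alpha>. 0 < a) \<and> sum_list \<alpha> = n}"

definition partial_sums :: "nat list \<Rightarrow> nat set" where
  "partial_sums \<alpha> = {sum_list (take i \<alpha>) | i. 1 \<le> i \<and> i < length \<alpha>}"

definition descents :: "nat \<Rightarrow> (nat \<Rightarrow> nat) \<Rightarrow> nat set" where
  "descents n w = {i \<in> {1..<n}. w i > w (i + 1)}"

definition B_comp :: "nat \<Rightarrow> nat list \<Rightarrow> (nat \<Rightarrow> nat) \<Rightarrow> 'k::comm_ring_1" where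
  "B_comp n \<alpha> =
     (\<lambda>w. \<Sum>u \<in> {u \<in> carrier (sym_group n). descents n u \<subseteq> partial_sums \<alpha>}. basis_elt u w)"

definition B_family :: "nat \<Rightarrow> (nat list \<Rightarrow> 'k) \<Rightarrow> (nat \<Rightarrow> nat) \<Rightarrow> 'k::comm_ring_1" where
  "B_family n \<gamma> = (\<lambda>w. \<Sum>\<alpha>\<in>compositions n. \<gamma> \<alpha> * B_comp n \<alpha> w)"

definition set_compositions :: "nat \<Rightarrow> nat set list set" where
  "set_compositions n =
     {F. {} \<notin> set F
         \<and> (\<forall>i<length F. \<forall>j<length F. i \<noteq> j \<longrightarrow> F ! i \<inter> F ! j = {})
         \<and> \<Union> (set F) = {1..n}}"

definition comp_type :: "nat set list \<Rightarrow> nat list" where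
  "comp_type F = map card F"

definition blocks_within :: "nat set list \<Rightarrow> nat set list \<Rightarrow> bool" where
  "blocks_within F G \<longleftrightarrow> (\<forall>A\<in>set F. \<exists>B\<in>set G. A \<subseteq> B)"

definition n_comp :: "nat \<Rightarrow> nat list \<Rightarrow> nat set list \<Rightarrow> nat" where
  "n_comp n \<alpha> F = card {G \<in> set_compositions n. blocks_within F G \<and> comp_type G = \<alpha>}"

definition nt_comp :: "nat \<Rightarrow> nat list \<Rightarrow> nat set list \<Rightarrow> int" where
  "nt_comp n \<alpha> F = (-1) ^ (n - length F) * int (n_comp n \<alpha> F)"

definition nt_family :: "nat \<Rightarrow> (nat list \<Rightarrow> 'k) \<Rightarrow> nat set list \<Rightarrow> 'k::comm_ring_1" where
  "nt_family n \<gamma> F = (\<Sum>\<alpha>\<in>compositions n. \<gamma> \<alpha> * of_int (nt_comp n \<alpha> F))"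

text \<open>
  \<open>\<iota>\<close> identifies a unital subring \<open>S\<close> of the reals with a subring of the ordered ring \<open>'k\<close>,
  compatibly with the orders. This is how an ordered commutative ring can contain given real
  numbers without having to contain all of them.
\<close>

definition real_subring_embedding ::
    "real set \<Rightarrow> (real \<Rightarrow> 'k::{comm_ring_1, linordered_ring}) \<Rightarrow> bool" where
  "real_subring_embedding S \<iota> \<longleftrightarrow>
     1 \<in> S \<and> \<iota> 1 = 1 \<and>
     (\<forall>x\<in>S. \<forall>y\<in>S. x - y \<in> S \<and> x * y \<in> S
                 \<and> \<iota> (x - y) = \<iota> x - \<iota> y \<and> \<iota> (x * y) = \<iota> x * \<iota> y
                 \<and> (x < y \<longrightarrow> \<iota> x < \<iota> y))"

lemma finite_sym_group: "finite (carrier (sym_group n))"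
  by (simp add: sym_group_def finite_permutations)

lemma sym_group_algebra_mult:
  "(f \<otimes>\<^bsub>sym_group_algebra n\<^esub> g) w =
     (\<Sum>u\<in>carrier (sym_group n). \<Sum>v\<in>carrier (sym_group n). if u \<circ> v = w then f u * g v else 0)"
proof -
  let ?S = "carrier (sym_group n)"
  have "(f \<otimes>\<^bsub>sym_group_algebra n\<^esub> g) w = (\<Sum>p\<in>{p \<in> ?S \<times> ?S. fst p \<circ> snd p = w}. f (fst p) * g (snd p))"
    by (auto simp: sym_group_algebra_def sym_group_mult case_prod_unfold intro!: sum.cong)
  also have "\<dots> = (\<Sum>p\<in>?S \<times> ?S. if fst p \<circ> snd p = w then f (fst p) * g (snd p) else 0)"
    by (rule sum.inter_filter) (simp add: finite_sym_group)
  also have "\<dots> = (\<Sum>u\<in>?S. \<Sum>v\<in>?S. if u \<circ> v = w then f u * g v else 0)"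
    by (simp add: sum.cartesian_product case_prod_unfold)
  finally show ?thesis .
qed

lemma ring_sym_group_algebra: "ring (sym_group_algebra n :: ((nat \<Rightarrow> nat) \<Rightarrow> 'k::comm_ring_1) ring)"
proof -
  let ?S = "carrier (sym_group n)"
  let ?A = "sym_group_algebra n :: ((nat \<Rightarrow> nat) \<Rightarrow> 'k) ring"
  have fin: "finite ?S" by (rule finite_sym_group)
  have clo: "u \<circ> v \<in> ?S" if "u \<in> ?S" "v \<in> ?S" for u v
    using that by (simp add: sym_group_def permutes_compose)
  have ids: "id \<in> ?S" by (simp add: sym_group_def permutes_id)
  have car: "f \<in> carrier ?A \<longleftrightarrow> (\<forall>w. w \<notin> ?S \<longrightarrow> f w = 0)" for f
    by (simp add: sym_group_algebra_def)
  have ad: "f \<oplus>\<^bsub>?A\<^esub> g = (\<lambda>w. f w + g w)" and ze: "\<zero>\<^bsub>?A\<^esub> = (\<lambda>_. 0)"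
    and one: "\<one>\<^bsub>?A\<^esub> = (\<lambda>w. if w = id then 1 else 0)" for f g
    by (simp_all add: sym_group_algebra_def sym_group_one)
  have mcl: "f \<otimes>\<^bsub>?A\<^esub> g \<in> carrier ?A" for f g
    unfolding car sym_group_algebra_mult
    by (intro allI impI sum.neutral ballI) (use clo in auto)
  have L: "((f \<otimes>\<^bsub>?A\<^esub> g) \<otimes>\<^bsub>?A\<^esub> h) w =
      (\<Sum>u\<in>?S. \<Sum>v\<in>?S. \<Sum>c\<in>?S. if u \<circ> v \<circ> c = w then f u * g v * h c else 0)" for f g h w
  proof -
    have "((f \<otimes>\<^bsub>?A\<^esub> g) \<otimes>\<^bsub>?A\<^esub> h) w =
       (\<Sum>a\<in>?S. \<Sum>c\<in>?S. \<Sum>u\<in>?S. \<Sum>v\<in>?S. if u \<circ> v = a then (if a \<circ> c = w then f u * g v * h c else 0) else 0)"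
      unfolding sym_group_algebra_mult
      by (intro sum.cong refl) (auto simp: sum_distrib_right intro!: sum.cong sum.neutral)
    also have "\<dots> = (\<Sum>u\<in>?S. \<Sum>v\<in>?S. \<Sum>c\<in>?S. \<Sum>a\<in>?S. if u \<circ> v = a then (if a \<circ> c = w then f u * g v * h c else 0) else 0)"
      apply (subst (2) sum.swap)
      apply (subst (1) sum.swap)
      apply (subst (3) sum.swap)
      apply (subst (2) sum.swap)
      apply (subst (3) sum.swap)
      apply (subst (1) sum.swap)
      apply (subst (3) sum.swap)
      apply (rule refl)
      done
    also have "\<dots> = (\<Sum>u\<in>?S. \<Sum>v\<in>?S. \<Sum>c\<in>?S. if u \<circ> v \<circ> c = w then f u * g v * h c else 0)"
      using fin clo by (intro sum.cong refl) (simp add: sum.delta')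
    finally show ?thesis .
  qed
  have R: "(f \<otimes>\<^bsub>?A\<^esub> (g \<otimes>\<^bsub>?A\<^esub> h)) w =
      (\<Sum>u\<in>?S. \<Sum>v\<in>?S. \<Sum>c\<in>?S. if u \<circ> v \<circ> c = w then f u * g v * h c else 0)" for f g h w
  proof -
    have "(f \<otimes>\<^bsub>?A\<^esub> (g \<otimes>\<^bsub>?A\<^esub> h)) w =
       (\<Sum>u\<in>?S. \<Sum>a\<in>?S. \<Sum>v\<in>?S. \<Sum>c\<in>?S. if v \<circ> c = a then (if u \<circ> a = w then f u * g v * h c else 0) else 0)"
      unfolding sym_group_algebra_mult
      by (intro sum.cong refl) (auto simp: sum_distrib_left mult.assoc intro!: sum.cong sum.neutral)
    also have "\<dots> = (\<Sum>u\<in>?S. \<Sum>v\<in>?S. \<Sum>c\<in>?S. \<Sum>a\<in>?S. if v \<circ> c = a then (if u \<circ> a = w then f u * g v * h c else 0) else 0)"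
      apply (subst (2) sum.swap)
      apply (subst (3) sum.swap)
      apply (subst (1) sum.swap)
      apply (subst (3) sum.swap)
      apply (rule refl)
      done
    also have "\<dots> = (\<Sum>u\<in>?S. \<Sum>v\<in>?S. \<Sum>c\<in>?S. if u \<circ> v \<circ> c = w then f u * g v * h c else 0)"
      using fin clo by (intro sum.cong refl) (simp add: sum.delta' comp_assoc)
    finally show ?thesis .
  qed
  show ?thesis
  proof (rule ringI)
    show "abelian_group ?A"
    proof (rule abelian_groupI)
      fix f assume "f \<in> carrier ?A"
      then show "\<exists>g\<in>carrier ?A. g \<oplus>\<^bsub>?A\<^esub> f = \<zero>\<^bsub>?A\<^esub>"
        by (intro bexI[of _ "\<lambda>w. - f w"]) (simp_all add: car ad ze)
    qed (simp_all add: car ad ze fun_eq_iff algebra_simps)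
    show "monoid ?A"
    proof (rule monoidI)
      fix f assume f: "f \<in> carrier ?A"
      show "\<one>\<^bsub>?A\<^esub> \<otimes>\<^bsub>?A\<^esub> f = f"
      proof
        fix w
        have "(\<one>\<^bsub>?A\<^esub> \<otimes>\<^bsub>?A\<^esub> f) w = (\<Sum>u\<in>?S. if u = id then (\<Sum>v\<in>?S. if v = w then f v else 0) else 0)"
          unfolding sym_group_algebra_mult one by (intro sum.cong refl) (auto intro!: sum.cong sum.neutral)
        then show "(\<one>\<^bsub>?A\<^esub> \<otimes>\<^bsub>?A\<^esub> f) w = f w"
          using f fin ids by (auto simp: car sum.delta)
      qed
      show "f \<otimes>\<^bsub>?A\<^esub> \<one>\<^bsub>?A\<^esub> = f"
      proof
        fix w
        have "(f \<otimes>\<^bsub>?A\<^esub> \<one>\<^bsub>?A\<^esub>) w = (\<Sum>u\<in>?S. \<Sum>v\<in>?S. if v = id then (if u = w then f u else 0) else 0)"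
          unfolding sym_group_algebra_mult one by (intro sum.cong refl) auto
        then show "(f \<otimes>\<^bsub>?A\<^esub> \<one>\<^bsub>?A\<^esub>) w = f w"
          using f fin ids by (auto simp: car sum.delta)
      qed
    next
      show "\<one>\<^bsub>?A\<^esub> \<in> carrier ?A" using ids by (auto simp: car one)
    next
      fix f g h
      show "f \<otimes>\<^bsub>?A\<^esub> g \<otimes>\<^bsub>?A\<^esub> h = f \<otimes>\<^bsub>?A\<^esub> (g \<otimes>\<^bsub>?A\<^esub> h)"
        by (rule ext) (simp only: L R)
    qed (rule mcl)
    fix f g h
    show "(f \<oplus>\<^bsub>?A\<^esub> g) \<otimes>\<^bsub>?A\<^esub> h = f \<otimes>\<^bsub>?A\<^esub> h \<oplus>\<^bsub>?A\<^esub> g \<otimes>\<^bsub>?A\<^esub> h"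
      unfolding ad by (rule ext) (auto simp: sym_group_algebra_mult sum.distrib[symmetric] algebra_simps intro!: sum.cong)
    show "h \<otimes>\<^bsub>?A\<^esub> (f \<oplus>\<^bsub>?A\<^esub> g) = h \<otimes>\<^bsub>?A\<^esub> f \<oplus>\<^bsub>?A\<^esub> h \<otimes>\<^bsub>?A\<^esub> g"
      unfolding ad by (rule ext) (auto simp: sym_group_algebra_mult sum.distrib[symmetric] algebra_simps intro!: sum.cong)
  qed
qed

lemma finite_compositions: "finite (compositions n)"
proof (rule finite_subset)
  show "compositions n \<subseteq> {\<alpha>. set \<alpha> \<subseteq> {..n} \<and> length \<alpha> \<le> n}"
  proof
    fix \<alpha> assume a: "\<alpha> \<in> compositions n"
    have "length \<alpha> \<le> sum_list \<alpha>" if "\<forall>a\<in>set \<alpha>. 0 < a"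
      using that by (induction \<alpha>) auto
    then show "\<alpha> \<in> {\<alpha>. set \<alpha> \<subseteq> {..n} \<and> length \<alpha> \<le> n}"
      using a by (auto simp: compositions_def member_le_sum_list)
  qed
qed (simp add: finite_lists_length_le)

lemma finite_set_compositions: "finite (set_compositions n)"
proof (rule finite_subset)
  show "set_compositions n \<subseteq> {F. set F \<subseteq> Pow {1..n} \<and> distinct F}"
  proof
    fix F assume F: "F \<in> set_compositions n"
    have "distinct F" unfolding distinct_conv_nth
    proof (intro allI impI)
      fix i j assume ij: "i < length F" "j < length F" "i \<noteq> j"
      then have "F ! i \<noteq> {}" using F nth_mem[of i F] by (metis (no_types, lifting) mem_Collect_eq set_compositions_def)
      moreover have "F ! i \<inter> F ! j = {}" using F ij by (auto simp: set_compositions_def)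
      ultimately show "F ! i \<noteq> F ! j" by auto
    qed
    moreover have "set F \<subseteq> Pow {1..n}" using F by (auto simp: set_compositions_def)
    ultimately show "F \<in> {F. set F \<subseteq> Pow {1..n} \<and> distinct F}" by simp
  qed
qed (rule finite_subset_distinct, simp)

end

theory Submission
  imports Defs
begin

text \<open>
  Right multiplication by \<open>B\<^sub>\<alpha>\<close> sends a permutation, read as a word in the letters \<open>1..n\<close>, to the sum of
  the words obtained by letting all set compositions \<open>G\<close> of type \<open>\<alpha>\<close> act on it, where \<open>G\<close> sorts the
  letters stably by their block index; right multiplication by \<open>w\<^sub>0\<close> reverses words. Multilinear
  words are spanned by products \<open>P\<^sub>1 \<cdots> P\<^sub>m\<close> of Lie polynomials whose letter sets form a set partition
  \<open>X\<close>. As Lie polynomials are primitive, \<open>G\<close> annihilates such a product unless every block of \<open>X\<close> lies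
  in a block of \<open>G\<close>, and otherwise it sorts the factors \<open>P\<^sub>j\<close>. Reversal yields
  \<open>(-1)\<^bsup>n - m\<^esup> P\<^sub>m \<cdots> P\<^sub>1\<close>. Swapping two adjacent factors costs the product in which they are replaced by
  their commutator, which merges two blocks of \<open>X\<close>.

  Filter the words by the weight \<open>n\<^sub>\<gamma>(X)\<close>. Since \<open>\<gamma> \<ge> 0\<close>, merging blocks does not increase the weight,
  and it decreases it strictly if some \<open>G\<close> with \<open>\<gamma>\<^sub>G \<noteq> 0\<close> separates the merged blocks. Hence \<open>B\<^sub>\<gamma>\<close> acts
  on the layer of weight \<open>\<lambda>\<close> as the scalar \<open>\<lambda>\<close>, and \<open>T = w\<^sub>0 B\<^sub>\<gamma>\<close> satisfies \<open>T\<^sup>2 = \<lambda>\<^sup>2\<close> there. If only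
  one sign \<open>\<epsilon> = (-1)\<^bsup>n - m\<^esup>\<close> occurs in the layer, any merge changes the sign and therefore leaves the
  layer, so that \<open>T = \<epsilon> \<lambda>\<close>. In both cases the factors \<open>T - k\<close> with \<open>\<bar>k\<bar> = \<lambda>\<close> annihilate the layer.
\<close>

section \<open>Products of Lie monomials\<close>

datatype lie = Letter nat | Bracket lie lie

primrec letters :: "lie \<Rightarrow> nat list" where
  "letters (Letter a) = [a]"
| "letters (Bracket s t) = letters s @ letters t"

text \<open>
  A Lie monomial, and below a product of Lie monomials, is represented by the linear functional that
  pairs a function on words with its expansion \<open>[s, t] = s t - t s\<close> into words.
\<close>

primrec ev :: "lie \<Rightarrow> (nat list \<Rightarrow> 'k::comm_ring_1) \<Rightarrow> 'k" where
  "ev (Letter a) f = f [a]"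
| "ev (Bracket s t) f = ev s (\<lambda>u. ev t (\<lambda>v. f (u @ v))) - ev t (\<lambda>v. ev s (\<lambda>u. f (v @ u)))"

primrec evs :: "lie list \<Rightarrow> (nat list \<Rightarrow> 'k::comm_ring_1) \<Rightarrow> 'k" where
  "evs [] f = f []"
| "evs (t # ts) f = ev t (\<lambda>u. evs ts (\<lambda>v. f (u @ v)))"

lemma letters_nonempty [simp]: "letters t \<noteq> []"
  by (induction t) auto

lemma ev_add: "ev t (\<lambda>w. f w + g w) = ev t f + ev t g"
  by (induction t arbitrary: f g) simp_all

lemma ev_cmult: "ev t (\<lambda>w. c * f w) = c * ev t f"
  by (induction t arbitrary: f) (simp_all add: algebra_simps)

lemma ev_zero [simp]: "ev t (\<lambda>w. 0) = 0"
  using ev_cmult[of t 0 "\<lambda>w. 0"] by simp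

lemma ev_diff: "ev t (\<lambda>w. f w - g w) = ev t f - ev t g"
  using ev_add[of t f "\<lambda>w. - 1 * g w"] unfolding ev_cmult by simp

text \<open>Both functionals are finite signed sums of evaluations, so they commute like iterated
  finite sums.\<close>

lemma ev_swap: "ev s (\<lambda>u. ev t (\<lambda>v. h u v)) = ev t (\<lambda>v. ev s (\<lambda>u. h u v))"
proof (induction s arbitrary: h)
  case (Bracket s1 s2)
  show ?case
    unfolding ev.simps ev_diff Bracket.IH(1)[symmetric] Bracket.IH(2)[symmetric] ..
qed simp

text \<open>Every word in the expansion of \<open>t\<close> rearranges \<open>letters t\<close>;
  later arguments need only its set of letters.\<close>

lemma ev_cong:
  assumes "\<And>w. set w = set (letters t) \<Longrightarrow> f w = g w"
  shows "ev t f = ev t g"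
  using assms
proof (induction t arbitrary: f g)
  case (Bracket s t)
  have "ev s (\<lambda>u. ev t (\<lambda>v. f (u @ v))) = ev s (\<lambda>u. ev t (\<lambda>v. g (u @ v)))"
    by (intro Bracket.IH Bracket.prems) simp
  moreover have "ev t (\<lambda>v. ev s (\<lambda>u. f (v @ u))) = ev t (\<lambda>v. ev s (\<lambda>u. g (v @ u)))"
    by (intro Bracket.IH Bracket.prems) auto
  ultimately show ?case by simp
qed simp

text \<open>Reversal is an anti-automorphism, so it negates every bracket. A monomial with m letters
  has m - 1 brackets; the exponent m + 1 has the same parity and avoids truncated
  subtraction.\<close>

lemma ev_rev: "ev t (\<lambda>w. f (rev w)) = (- 1) ^ (length (letters t) + 1) * ev t f"
proof (induction t arbitrary: f)
  case (Bracket s t)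
  let ?s = "(- 1 :: 'a) ^ (length (letters s) + 1)" and ?t = "(- 1 :: 'a) ^ (length (letters t) + 1)"
  have 1: "ev s (\<lambda>u. ev t (\<lambda>v. f (rev v @ rev u))) = ?s * ?t * ev t (\<lambda>v. ev s (\<lambda>u. f (v @ u)))"
    unfolding Bracket.IH(2)[of "\<lambda>v. f (v @ rev _)"] ev_cmult
      Bracket.IH(1)[of "\<lambda>u. ev t (\<lambda>v. f (v @ u))"] mult.assoc
    by (subst ev_swap) (simp add: mult.left_commute)
  have 2: "ev t (\<lambda>v. ev s (\<lambda>u. f (rev u @ rev v))) = ?s * ?t * ev s (\<lambda>u. ev t (\<lambda>v. f (u @ v)))"
    unfolding Bracket.IH(1)[of "\<lambda>v. f (v @ rev _)"] ev_cmult
      Bracket.IH(2)[of "\<lambda>u. ev s (\<lambda>v. f (v @ u))"] mult.assoc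
    by (subst ev_swap) simp
  show ?case
    using 1 2 by (simp add: power_add algebra_simps)
qed simp

lemma evs_add: "evs P (\<lambda>w. f w + g w) = evs P f + evs P g"
  by (induction P arbitrary: f g) (simp_all add: ev_add)

lemma evs_cmult: "evs P (\<lambda>w. c * f w) = c * evs P f"
  by (induction P arbitrary: f) (simp_all add: ev_cmult)

lemma evs_zero [simp]: "evs P (\<lambda>w. 0) = 0"
  using evs_cmult[of P 0 "\<lambda>w. 0"] by simp

lemma evs_diff: "evs P (\<lambda>w. f w - g w) = evs P f - evs P g"
  using evs_add[of P f "\<lambda>w. - 1 * g w"] unfolding evs_cmult by simp

lemma evs_sum: "evs P (\<lambda>w. \<Sum>i\<in>I. f i w) = (\<Sum>i\<in>I. evs P (f i))"
  by (induction I rule: infinite_finite_induct) (simp_all add: evs_add)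

lemma evs_append: "evs (P @ Q) f = evs P (\<lambda>u. evs Q (\<lambda>v. f (u @ v)))"
  by (induction P arbitrary: f) simp_all

lemma ev_evs_swap: "ev t (\<lambda>u. evs P (\<lambda>v. h u v)) = evs P (\<lambda>v. ev t (\<lambda>u. h u v))"
proof (induction P arbitrary: h)
  case (Cons s P)
  show ?case
    by (simp add: Cons.IH[symmetric]) (rule ev_swap)
qed simp

text \<open>The splitting of each word into one piece per factor is kept, since
  \<open>sorted_concat_colours\<close> has to know which letters come from which factor.\<close>

lemma evs_cong:
  assumes "\<And>ws. list_all2 (\<lambda>w t. set w = set (letters t)) ws P \<Longrightarrow> f (concat ws) = g (concat ws)"
  shows "evs P f = evs P g"
  using assms
proof (induction P arbitrary: f g)
  case (Cons t P)
  show ?case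
    unfolding evs.simps
  proof (intro ev_cong Cons.IH)
    fix u ws
    assume "set u = set (letters t)" "list_all2 (\<lambda>w t. set w = set (letters t)) ws P"
    then show "f (u @ concat ws) = g (u @ concat ws)"
      using Cons.prems[of "u # ws"] by simp
  qed
qed simp

lemma evs_rev:
  "evs P (\<lambda>w. f (rev w)) = (- 1) ^ (length (concat (map letters P)) + length P) * evs (rev P) f"
proof (induction P arbitrary: f)
  case (Cons t P)
  show ?case
    unfolding evs.simps rev_append rev.simps evs_append Cons.IH[of "\<lambda>v. f (v @ rev _)"] ev_cmult
      ev_evs_swap ev_rev[of t "\<lambda>u. f (_ @ u)"] evs_cmult
    by (simp add: power_add algebra_simps)
qed simp

text \<open>This is \<open>s t = t s + [s, t]\<close> inside a product. The error term has one
  factor less, and its weight is what the filtration controls.\<close>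

lemma evs_adjacent_swap:
  "evs (P @ s # t # Q) f = evs (P @ t # s # Q) f + evs (P @ Bracket s t # Q) f"
  by (simp add: evs_append evs_add[symmetric] ev_evs_swap)

section \<open>Quantities unchanged by admissible adjacent transpositions\<close>

text \<open>Insertion moves \<open>x\<close> past entries with strictly smaller key only, so each
  exchange involves different keys. The prefix \<open>xs\<close> collects the entries already
  passed, and \<open>M\<close> records that all lists met are rearrangements of one another.\<close>

lemma insort_key_invariant:
  assumes "\<And>us s t vs. \<lbrakk>mset (us @ s # t # vs) = M; k s \<noteq> k t\<rbrakk> \<Longrightarrow> \<Psi> (us @ s # t # vs) = \<Psi> (us @ t # s # vs)"
    and "mset (xs @ x # ys) = M"
  shows "\<Psi> (xs @ insort_key k x ys) = \<Psi> (xs @ x # ys)"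
  using assms(2)
proof (induction ys arbitrary: xs)
  case (Cons y ys)
  show ?case
  proof (cases "k x \<le> k y")
    case False
    then have "\<Psi> (xs @ x # y # ys) = \<Psi> (xs @ y # x # ys)"
      using Cons.prems by (intro assms(1)) auto
    moreover have "mset ((xs @ [y]) @ x # ys) = M"
      using Cons.prems by (simp add: add_mset_commute)
    ultimately show ?thesis
      using False Cons.IH[of "xs @ [y]"] by simp
  qed simp
qed simp

lemma sort_key_invariant:
  assumes "\<And>us s t vs. \<lbrakk>mset (us @ s # t # vs) = mset xs; k s \<noteq> k t\<rbrakk> \<Longrightarrow> \<Psi> (us @ s # t # vs) = \<Psi> (us @ t # s # vs)"
  shows "\<Psi> (sort_key k xs) = \<Psi> xs"
proof -
  have "\<Psi> (us @ sort_key k vs) = \<Psi> (us @ vs)" if "mset (us @ vs) = mset xs" for us vs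
    using that
  proof (induction vs arbitrary: us)
    case (Cons v vs)
    have "\<Psi> (us @ insort_key k v (sort_key k vs)) = \<Psi> (us @ v # sort_key k vs)"
      by (rule insort_key_invariant[where M = "mset xs"]) (use assms Cons.prems in auto)
    also have "\<dots> = \<Psi> (us @ v # vs)"
      using Cons.IH[of "us @ [v]"] Cons.prems by simp
    finally show ?case by simp
  qed simp
  from this[of "[]" xs] show ?thesis by simp
qed

lemma rev_invariant:
  assumes "\<And>us s t vs. mset (us @ s # t # vs) = mset xs \<Longrightarrow> \<Psi> (us @ s # t # vs) = \<Psi> (us @ t # s # vs)"
  shows "\<Psi> (rev xs) = \<Psi> xs"
proof -
  \<comment> \<open>Reversal is built from moves that carry the first entry to the end, one
    neighbour at a time.\<close>
  have move: "\<Psi> (us @ ys @ [x]) = \<Psi> (us @ x # ys)" if "mset (us @ x # ys) = mset xs" for us x ys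
    using that
  proof (induction ys arbitrary: us)
    case (Cons y ys)
    then show ?case
      using Cons.IH[of "us @ [y]"] assms[of us x y ys] by (simp add: add_mset_commute)
  qed simp
  have "\<Psi> (us @ rev ys) = \<Psi> (us @ ys)" if "mset (us @ ys) = mset xs" for us ys
    using that
  proof (induction ys arbitrary: us)
    case (Cons y ys)
    then show ?case
      using Cons.IH[of "us @ [y]"] move[of us y "rev ys"] by simp
  qed simp
  from this[of "[]" xs] show ?thesis by simp
qed

section \<open>Set compositions acting on products of Lie monomials\<close>

text \<open>The value is \<open>length G\<close> if \<open>a\<close> lies in no block of \<open>G\<close>.\<close>

definition block_index :: "nat set list \<Rightarrow> nat \<Rightarrow> nat" where
  "block_index G a = length (takeWhile (\<lambda>B. a \<notin> B) G)"

lemma block_index_eq: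
  assumes "G \<in> set_compositions n" "i < length G" "a \<in> G ! i"
  shows "block_index G a = i"
  unfolding block_index_def
proof (rule arg_cong[where f = length, of _ "take i G", THEN trans])
  show "takeWhile (\<lambda>B. a \<notin> B) G = take i G"
  proof (rule takeWhile_eq_take_P_nth)
    fix j
    assume "j < i" "j < length G"
    then have "G ! j \<inter> G ! i = {}"
      using assms by (simp add: set_compositions_def)
    then show "a \<notin> G ! j"
      using assms(3) by blast
  qed (use assms in simp)
qed (use assms in simp)

lemma block_index_nth:
  assumes "G \<in> set_compositions n" "a \<in> {1..n}"
  shows "block_index G a < length G" "a \<in> G ! block_index G a"
proof -
  have "a \<in> \<Union> (set G)"
    using assms by (simp add: set_compositions_def)
  then obtain i where "i < length G" "a \<in> G ! i"
    by (auto simp: in_set_conv_nth)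
  then show "block_index G a < length G" "a \<in> G ! block_index G a"
    using block_index_eq[OF assms(1)] by auto
qed

text \<open>Turns containment in a block into constancy of \<open>block_index\<close>, so that
  \<open>G\<close> can be treated as a colouring of the letters.\<close>

lemma subset_block_iff:
  assumes "G \<in> set_compositions n" "A \<subseteq> {1..n}" "x \<in> A"
  shows "(\<exists>B\<in>set G. A \<subseteq> B) \<longleftrightarrow> (\<forall>a\<in>A. block_index G a = block_index G x)"
proof
  assume "\<exists>B\<in>set G. A \<subseteq> B"
  then obtain i where "i < length G" "A \<subseteq> G ! i"
    by (auto simp: in_set_conv_nth)
  then have "block_index G a = i" if "a \<in> A" for a
    using block_index_eq[OF assms(1)] that by blast
  then show "\<forall>a\<in>A. block_index G a = block_index G x"
    using assms by simp
next
  assume *: "\<forall>a\<in>A. block_index G a = block_index G x"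
  show "\<exists>B\<in>set G. A \<subseteq> B"
  proof
    show "G ! block_index G x \<in> set G"
      using block_index_nth[OF assms(1)] assms by auto
    show "A \<subseteq> G ! block_index G x"
    proof
      fix a
      assume "a \<in> A"
      then show "a \<in> G ! block_index G x"
        using block_index_nth(2)[OF assms(1), of a] assms(2) * by auto
    qed
  qed
qed

text \<open>These are the functions on the partially commutative monoid in which letters of
  different colours commute.\<close>

definition adjacent_invariant :: "(nat \<Rightarrow> nat) \<Rightarrow> (nat list \<Rightarrow> 'k) \<Rightarrow> bool" where
  "adjacent_invariant \<chi> g \<longleftrightarrow>
     (\<forall>u a b v. \<chi> a \<noteq> \<chi> b \<longrightarrow> g (u @ a # b # v) = g (u @ b # a # v))"

lemma adjacent_invariant_append:
  assumes "adjacent_invariant \<chi> g" "\<And>a b. \<lbrakk>a \<in> set x; b \<in> set y\<rbrakk> \<Longrightarrow> \<chi> a \<noteq> \<chi> b"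
  shows "g (u @ x @ y @ v) = g (u @ y @ x @ v)"
  using assms(2)
proof (induction x arbitrary: v rule: rev_induct)
  case (snoc a x)
  have *: "g (w @ a # z @ v) = g (w @ z @ a # v)" if "\<forall>b\<in>set z. \<chi> a \<noteq> \<chi> b" for w z
    using that
  proof (induction z arbitrary: w)
    case (Cons b z)
    then have "g (w @ a # b # z @ v) = g (w @ b # a # z @ v)"
      using assms(1) unfolding adjacent_invariant_def by (metis list.set_intros(1))
    also have "\<dots> = g (w @ b # z @ a # v)"
      using Cons.IH[of "w @ [b]"] Cons.prems by simp
    finally show ?case by simp
  qed simp
  have "g (u @ (x @ [a]) @ y @ v) = g (u @ x @ y @ a # v)"
    using *[of y "u @ x"] snoc.prems by simp
  also have "\<dots> = g (u @ y @ x @ a # v)"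
    using snoc.prems by (intro snoc.IH) auto
  finally show ?case by simp
qed simp

text \<open>A stable sort depends only on the subword of each colour, and exchanging two neighbours
  of different colours changes none of these subwords.\<close>

lemma adjacent_invariant_sort_key: "adjacent_invariant \<chi> (\<lambda>w. f (sort_key \<chi> w))"
proof -
  have "sort_key \<chi> (u @ a # b # v) = sort_key \<chi> (u @ b # a # v)" if "\<chi> a \<noteq> \<chi> b" for u a b v
  proof (rule properties_for_sort_key)
    fix k
    show "filter (\<lambda>x. \<chi> k = \<chi> x) (sort_key \<chi> (u @ b # a # v)) = filter (\<lambda>x. \<chi> k = \<chi> x) (u @ a # b # v)"
      using sort_key_stable[of \<chi> "\<chi> k" "u @ b # a # v"] that by (auto simp: eq_commute[of "\<chi> k"])
  qed simp_all
  then show ?thesis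
    by (simp add: adjacent_invariant_def)
qed

section \<open>Lie monomials under a colouring of the letters\<close>

definition monochromatic :: "(nat \<Rightarrow> nat) \<Rightarrow> lie \<Rightarrow> bool" where
  "monochromatic \<chi> t \<longleftrightarrow> (\<forall>a\<in>set (letters t). \<chi> a = \<chi> (hd (letters t)))"

abbreviation colour :: "(nat \<Rightarrow> nat) \<Rightarrow> lie \<Rightarrow> nat" where
  "colour \<chi> t \<equiv> \<chi> (hd (letters t))"

lemma monochromaticD: "monochromatic \<chi> t \<Longrightarrow> a \<in> set (letters t) \<Longrightarrow> \<chi> a = colour \<chi> t"
  by (simp only: monochromatic_def)

lemma monochromatic_bracket:
  "monochromatic \<chi> (Bracket s t) \<longleftrightarrow> monochromatic \<chi> s \<and> monochromatic \<chi> t \<and> colour \<chi> s = colour \<chi> t"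
proof -
  have "set (letters (Bracket s t)) = set (letters s) \<union> set (letters t)" "colour \<chi> (Bracket s t) = colour \<chi> s"
    by simp_all
  then show ?thesis
    using hd_in_set[OF letters_nonempty[of t]] unfolding monochromatic_def by (metis Un_iff)
qed

lemma ev_commute:
  assumes "adjacent_invariant \<chi> g" "monochromatic \<chi> s" "monochromatic \<chi> t" "colour \<chi> s \<noteq> colour \<chi> t"
  shows "ev s (\<lambda>x. ev t (\<lambda>y. g (u @ x @ y @ v))) = ev t (\<lambda>y. ev s (\<lambda>x. g (u @ y @ x @ v)))"
proof -
  have "ev s (\<lambda>x. ev t (\<lambda>y. g (u @ x @ y @ v))) = ev s (\<lambda>x. ev t (\<lambda>y. g (u @ y @ x @ v)))"
  proof (intro ev_cong adjacent_invariant_append[OF assms(1)])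
    fix x y a b
    assume "set x = set (letters s)" "set y = set (letters t)" "a \<in> set x" "b \<in> set y"
    then show "\<chi> a \<noteq> \<chi> b"
      using assms(4) monochromaticD[OF assms(2), of a] monochromaticD[OF assms(3), of b] by simp
  qed
  then show ?thesis
    by (simp add: ev_swap[of s])
qed

text \<open>A Lie polynomial is primitive, so its proper restrictions vanish.\<close>

lemma ev_not_monochromatic:
  assumes "adjacent_invariant \<chi> g" "\<not> monochromatic \<chi> t"
  shows "ev t (\<lambda>x. g (u @ x @ v)) = 0"
  using assms(2)
proof (induction t arbitrary: u v)
  case (Letter a)
  then show ?case by (simp add: monochromatic_def)
next
  case (Bracket s t)
  consider "\<not> monochromatic \<chi> s" | "\<not> monochromatic \<chi> t"
    | "monochromatic \<chi> s" "monochromatic \<chi> t" "colour \<chi> s \<noteq> colour \<chi> t"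
    using Bracket.prems monochromatic_bracket by blast
  then show ?case
  proof cases
    case 1
    \<comment> \<open>A word \<open>y\<close> from the other factor is absorbed into the context
      \<open>u\<close>, \<open>v\<close>, which is why both are arbitrary in the induction;
      \<open>ev_swap\<close> then makes \<open>ev s\<close> the inner functional.\<close>
    have "ev s (\<lambda>x. g (u @ x @ y @ v)) = 0" "ev s (\<lambda>x. g (u @ y @ x @ v)) = 0" for y
      using Bracket.IH(1)[OF 1, of u "y @ v"] Bracket.IH(1)[OF 1, of "u @ y" v] by simp_all
    then show ?thesis by (simp add: ev_swap[of s])
  next
    case 2
    have "ev t (\<lambda>x. g (u @ x @ y @ v)) = 0" "ev t (\<lambda>x. g (u @ y @ x @ v)) = 0" for y
      using Bracket.IH(2)[OF 2, of u "y @ v"] Bracket.IH(2)[OF 2, of "u @ y" v] by simp_all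
    then show ?thesis by (simp add: ev_swap[of t])
  next
    case 3
    \<comment> \<open>The two factors commute under \<open>g\<close>, so the two terms of the
      bracket cancel.\<close>
    then show ?thesis using ev_commute[OF assms(1)] by simp
  qed
qed

lemma evs_not_monochromatic:
  assumes "adjacent_invariant \<chi> g" "t \<in> set P" "\<not> monochromatic \<chi> t"
  shows "evs P g = 0"
proof -
  obtain Q R where P: "P = Q @ t # R"
    using split_list[OF assms(2)] by blast
  have "ev t (\<lambda>x. evs R (\<lambda>v. g (u @ x @ v))) = 0" for u
    by (simp add: ev_evs_swap ev_not_monochromatic[OF assms(1,3)])
  then show ?thesis
    by (simp add: P evs_append)
qed

lemma evs_swap_colours:
  assumes "adjacent_invariant \<chi> g" "monochromatic \<chi> s" "monochromatic \<chi> t" "colour \<chi> s \<noteq> colour \<chi> t"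
  shows "evs (P @ s # t # Q) g = evs (P @ t # s # Q) g"
  by (simp add: evs_append ev_evs_swap ev_commute[OF assms])

text \<open>All letters of a factor share its colour, so ordering the factors by colour already
  orders the letters of every expanded word.\<close>

lemma sorted_concat_colours:
  assumes "list_all2 (\<lambda>w t. set w = set (letters t)) ws P" "\<forall>t\<in>set P. monochromatic \<chi> t"
    "sorted (map (colour \<chi>) P)"
  shows "sorted (map \<chi> (concat ws))"
  using assms
proof (induction rule: list_all2_induct)
  case (Cons w ws t P)
  have w: "\<chi> a = colour \<chi> t" if "a \<in> set w" for a
    using that Cons.hyps(1) Cons.prems(1) monochromaticD[of \<chi> t a] by simp
  have ws: "colour \<chi> t \<le> \<chi> a" if a: "a \<in> set (concat ws)" for a
  proof -
    have "\<exists>t'\<in>set P. a \<in> set (letters t')"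
      using Cons.hyps(2) a by (induction rule: list_all2_induct) auto
    then obtain t' where t': "t' \<in> set P" "a \<in> set (letters t')"
      by blast
    then have "\<chi> a = colour \<chi> t'"
      using Cons.prems(1) monochromaticD[of \<chi> t' a] by simp
    then show ?thesis
      using Cons.prems(2) t'(1) by simp
  qed
  have "sorted (map \<chi> w)"
    by (simp add: sorted_iff_nth_mono w)
  moreover have "sorted (map \<chi> (concat ws))"
    using Cons.prems by (intro Cons.IH) simp_all
  ultimately show ?case
    unfolding concat.simps map_append sorted_append by (auto simp: w ws simp del: set_concat)
qed simp

text \<open>If the factors are sorted, sorting the letters changes nothing. The sorting of the
  factors can then be undone, because under \<open>?g\<close> factors of different colours
  commute.\<close>

lemma evs_sort_key:
  assumes "\<forall>t\<in>set P. monochromatic \<chi> t"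
  shows "evs P (\<lambda>w. f (sort_key \<chi> w)) = evs (sort_key (colour \<chi>) P) f"
proof -
  let ?g = "\<lambda>w. f (sort_key \<chi> w)"
  have "evs (sort_key (colour \<chi>) P) f = evs (sort_key (colour \<chi>) P) ?g"
  proof (rule evs_cong)
    fix ws
    assume "list_all2 (\<lambda>w t. set w = set (letters t)) ws (sort_key (colour \<chi>) P)"
    then have "sorted (map \<chi> (concat ws))"
      by (rule sorted_concat_colours) (use assms in auto)
    then show "f (concat ws) = f (sort_key \<chi> (concat ws))"
      by (simp add: sort_key_id_if_sorted)
  qed
  also have "\<dots> = evs P ?g"
  proof (rule sort_key_invariant)
    fix us s t vs
    assume m: "mset (us @ s # t # vs) = mset P" "colour \<chi> s \<noteq> colour \<chi> t"
    have "set (us @ s # t # vs) = set P"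
      using m(1) by (rule mset_eq_setD)
    then show "evs (us @ s # t # vs) ?g = evs (us @ t # s # vs) ?g"
      using m(2) assms by (intro evs_swap_colours[OF adjacent_invariant_sort_key]) auto
  qed
  finally show ?thesis ..
qed

section \<open>The weight filtration\<close>

lemma comp_type_in_compositions:
  assumes "G \<in> set_compositions n"
  shows "comp_type G \<in> compositions n"
proof -
  have fin: "finite (\<Union> (set G))" and ne: "{} \<notin> set G"
    using assms by (simp_all add: set_compositions_def)
  have "finite B" if "B \<in> set G" for B
    using fin that by (meson Sup_upper finite_subset)
  then have pos: "\<forall>a\<in>set (comp_type G). 0 < a"
    using ne by (auto simp: comp_type_def card_gt_0_iff)
  have "sum_list (map card G) = (\<Sum>i<length G. card (G ! i))"
    by (simp add: sum_list_sum_nth atLeast0LessThan)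
  also have "\<dots> = card (\<Union>i\<in>{..<length G}. G ! i)"
    using assms \<open>\<And>B. B \<in> set G \<Longrightarrow> finite B\<close>
    by (intro card_UN_disjoint[symmetric]) (simp_all add: set_compositions_def)
  also have "(\<Union>i\<in>{..<length G}. G ! i) = \<Union> (set G)"
    by (auto simp: set_conv_nth)
  finally show ?thesis
    using assms pos by (simp add: compositions_def comp_type_def set_compositions_def)
qed

text \<open>Multilinear products of Lie monomials: the factors are binary trees whose leaves carry
  each of \<open>1..n\<close> exactly once.\<close>

definition forests :: "nat \<Rightarrow> lie list set" where
  "forests n = {P. distinct (concat (map letters P)) \<and> set (concat (map letters P)) = {1..n}}"

abbreviation blocks :: "lie list \<Rightarrow> nat set list" where
  "blocks P \<equiv> map (\<lambda>t. set (letters t)) P"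

lemma set_compositions_of_lists:
  assumes d: "distinct (concat yss)" and u: "set (concat yss) = {1..n}" and ne: "[] \<notin> set yss"
  shows "map set yss \<in> set_compositions n"
proof -
  have "removeAll [] yss = yss"
    using ne by (rule removeAll_id)
  then have d': "distinct yss" and
    disj: "\<And>xs ys. \<lbrakk>xs \<in> set yss; ys \<in> set yss; xs \<noteq> ys\<rbrakk> \<Longrightarrow> set xs \<inter> set ys = {}"
    using d by (simp_all add: distinct_concat_iff)
  have "map set yss ! i \<inter> map set yss ! j = {}" if ij: "i < length yss" "j < length yss" "i \<noteq> j" for i j
  proof -
    have "yss ! i \<noteq> yss ! j"
      using d' ij by (simp add: distinct_conv_nth)
    then show ?thesis
      using disj[of "yss ! i" "yss ! j"] ij by simp
  qed
  then show ?thesis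
    using u ne by (auto simp: set_compositions_def)
qed

lemma blocks_in_set_compositions:
  assumes "P \<in> forests n"
  shows "blocks P \<in> set_compositions n"
proof -
  have "[] \<notin> set (map letters P)"
    using letters_nonempty by (metis ex_map_conv)
  from set_compositions_of_lists[OF _ _ this, of n] show ?thesis
    using assms by (simp add: forests_def comp_def)
qed

lemma forests_mset:
  assumes "mset P = mset Q" "Q \<in> forests n"
  shows "P \<in> forests n"
proof -
  have "mset (concat (map letters R)) = sum_mset (image_mset (\<lambda>t. mset (letters t)) (mset R))" for R
    by (induction R) simp_all
  then have "mset (concat (map letters P)) = mset (concat (map letters Q))"
    using assms(1) by simp
  then show ?thesis
    using assms(2) mset_eq_imp_distinct_iff mset_eq_setD unfolding forests_def by blast
qed

lemma forests_bracket: "P @ s # t # Q \<in> forests n \<Longrightarrow> P @ Bracket s t # Q \<in> forests n"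
  by (simp add: forests_def Un_assoc)

lemma length_letters_forest:
  assumes "P \<in> forests n"
  shows "length (concat (map letters P)) = n"
  using assms distinct_card[of "concat (map letters P)"] by (simp add: forests_def del: distinct_card)

lemma length_forest_le:
  assumes "P \<in> forests n"
  shows "length P \<le> n"
proof -
  have "length P \<le> length (concat (map letters P))"
  proof (induction P)
    case (Cons t P)
    then show ?case
      using letters_nonempty[of t] by (cases "letters t") auto
  qed simp
  then show ?thesis
    using length_letters_forest[OF assms] by simp
qed

lemma blocks_within_iff_monochromatic:
  assumes "P \<in> forests n" "G \<in> set_compositions n"
  shows "blocks_within (blocks P) G \<longleftrightarrow> (\<forall>t\<in>set P. monochromatic (block_index G) t)"
proof -
  have "(\<exists>B\<in>set G. set (letters t) \<subseteq> B) \<longleftrightarrow> monochromatic (block_index G) t" if "t \<in> set P" for t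
    unfolding monochromatic_def
  proof (rule subset_block_iff[OF assms(2)])
    show "set (letters t) \<subseteq> {1..n}"
      using assms(1) that by (auto simp: forests_def)
  qed simp
  then show ?thesis
    by (simp add: blocks_within_def)
qed

definition coarse_weight :: "nat \<Rightarrow> (nat list \<Rightarrow> 'k::comm_ring_1) \<Rightarrow> nat set list \<Rightarrow> 'k" where
  "coarse_weight n \<gamma> F = (\<Sum>G | G \<in> set_compositions n \<and> blocks_within F G. \<gamma> (comp_type G))"

text \<open>Grouping the set compositions \<open>G\<close> by type yields
  \<open>n_comp n \<alpha> F\<close> equal terms for each \<alpha>; the sign depends on
  \<open>F\<close> alone.\<close>

lemma nt_family_eq: "nt_family n \<gamma> F = (- 1) ^ (n - length F) * coarse_weight n \<gamma> F"
proof -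
  let ?S = "{G. G \<in> set_compositions n \<and> blocks_within F G}"
  have "coarse_weight n \<gamma> F = (\<Sum>\<alpha>\<in>compositions n. \<Sum>G | G \<in> ?S \<and> comp_type G = \<alpha>. \<gamma> (comp_type G))"
    unfolding coarse_weight_def
    by (rule sum.group[symmetric])
      (auto simp: finite_set_compositions finite_compositions comp_type_in_compositions)
  also have "\<dots> = (\<Sum>\<alpha>\<in>compositions n. of_nat (n_comp n \<alpha> F) * \<gamma> \<alpha>)"
    by (intro sum.cong refl) (simp add: n_comp_def conj_assoc)
  finally show ?thesis
    by (simp add: nt_family_def nt_comp_def sum_distrib_left mult_ac)
qed

section \<open>Operators on functions of words\<close>

text \<open>The product of the operators \<open>T - k\<close>, with the first entry outermost to
  agree with \<open>list_prod\<close>.\<close>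

primrec factors :: "((nat list \<Rightarrow> 'k) \<Rightarrow> nat list \<Rightarrow> 'k) \<Rightarrow> 'k::comm_ring_1 list \<Rightarrow> (nat list \<Rightarrow> 'k) \<Rightarrow> nat list \<Rightarrow> 'k"
  where
  "factors T [] f = f"
| "factors T (k # ks) f = (\<lambda>w. T (factors T ks f) w - k * factors T ks f w)"

definition face_op :: "nat \<Rightarrow> (nat list \<Rightarrow> 'k::comm_ring_1) \<Rightarrow> (nat list \<Rightarrow> 'k) \<Rightarrow> nat list \<Rightarrow> 'k" where
  "face_op n \<gamma> f = (\<lambda>w. \<Sum>G\<in>set_compositions n. \<gamma> (comp_type G) * f (sort_key (block_index G) w))"

definition rev_face_op :: "nat \<Rightarrow> (nat list \<Rightarrow> 'k::comm_ring_1) \<Rightarrow> (nat list \<Rightarrow> 'k) \<Rightarrow> nat list \<Rightarrow> 'k" where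
  "rev_face_op n \<gamma> f = (\<lambda>w. face_op n \<gamma> f (rev w))"

lemma rev_face_op_diff_cmult:
  "rev_face_op n \<gamma> (\<lambda>w. f w - c * g w) w = rev_face_op n \<gamma> f w - c * rev_face_op n \<gamma> g w"
  by (simp add: rev_face_op_def face_op_def sum_subtractf right_diff_distrib sum_distrib_left mult.left_commute)

text \<open>Linearity of the operator makes the factors commute, so any chosen factor can be moved
  to the outside.\<close>

lemma factors_remove1:
  "k \<in> set ks \<Longrightarrow> factors (rev_face_op n \<gamma>) ks f = factors (rev_face_op n \<gamma>) (k # remove1 k ks) f"
proof (induction ks)
  case (Cons l ks)
  show ?case
  proof (cases "l = k")
    case False
    then have "factors (rev_face_op n \<gamma>) (l # ks) f = factors (rev_face_op n \<gamma>) (l # k # remove1 k ks) f"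
      using Cons by simp
    also have "\<dots> = factors (rev_face_op n \<gamma>) (k # l # remove1 k ks) f"
      by (simp add: rev_face_op_diff_cmult algebra_simps)
    finally show ?thesis
      using False by simp
  qed simp
qed simp

section \<open>The weight filtration and the operators preserving it\<close>

locale weighted_faces =
  fixes n :: nat and \<gamma> :: "nat list \<Rightarrow> 'k::{comm_ring_1, linordered_ring}"
  assumes nonneg: "\<alpha> \<in> compositions n \<Longrightarrow> 0 \<le> \<gamma> \<alpha>"
begin

abbreviation "wt P \<equiv> coarse_weight n \<gamma> (blocks P)"

text \<open>Such an \<open>h\<close> is a functional modulo the span of the products of weight less
  than \<open>c\<close>, so under it the commutators of lower weight disappear.\<close>

definition vanishes_below :: "'k \<Rightarrow> (nat list \<Rightarrow> 'k) \<Rightarrow> bool" where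
  "vanishes_below c h \<longleftrightarrow> (\<forall>P\<in>forests n. wt P < c \<longrightarrow> evs P h = 0)"

lemma weight_nonneg: "0 \<le> coarse_weight n \<gamma> F"
  unfolding coarse_weight_def by (intro sum_nonneg nonneg) (auto intro: comp_type_in_compositions)

lemma weight_mset: "mset P = mset Q \<Longrightarrow> wt P = wt Q"
  unfolding coarse_weight_def blocks_within_def set_map by (drule mset_eq_setD) (simp only:)

lemma blocks_within_bracket:
  "blocks_within (blocks (P @ Bracket s t # Q)) G \<Longrightarrow> blocks_within (blocks (P @ s # t # Q)) G"
  unfolding blocks_within_def by (simp add: ball_Un) blast

lemma weight_bracket_le: "wt (P @ Bracket s t # Q) \<le> wt (P @ s # t # Q)"
  unfolding coarse_weight_def
proof (rule sum_mono2)
  show "0 \<le> \<gamma> (comp_type G)"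
    if "G \<in> {G. G \<in> set_compositions n \<and> blocks_within (blocks (P @ s # t # Q)) G} -
      {G. G \<in> set_compositions n \<and> blocks_within (blocks (P @ Bracket s t # Q)) G}" for G
    using that by (intro nonneg comp_type_in_compositions) blast
qed (simp add: finite_set_compositions, use blocks_within_bracket in blast)

text \<open>Before the merge \<open>G\<close> contributes to the weight, afterwards it does not,
  since the new factor has letters in two of its blocks. The loss is the positive number
  \<open>\<gamma> (comp_type G)\<close>.\<close>

lemma weight_bracket_less:
  assumes "P @ s # t # Q \<in> forests n" "G \<in> set_compositions n" "\<gamma> (comp_type G) \<noteq> 0"
    "blocks_within (blocks (P @ s # t # Q)) G" "colour (block_index G) s \<noteq> colour (block_index G) t"
  shows "wt (P @ Bracket s t # Q) < wt (P @ s # t # Q)"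
  unfolding coarse_weight_def
proof (rule sum_strict_mono2)
  have "\<not> blocks_within (blocks (P @ Bracket s t # Q)) G"
    using assms(5) monochromatic_bracket[of "block_index G" s t]
    unfolding blocks_within_iff_monochromatic[OF forests_bracket[OF assms(1)] assms(2)] by auto
  then show "G \<in> {G. G \<in> set_compositions n \<and> blocks_within (blocks (P @ s # t # Q)) G} -
      {G. G \<in> set_compositions n \<and> blocks_within (blocks (P @ Bracket s t # Q)) G}"
    using assms by simp
  show "0 < \<gamma> (comp_type G)"
    using nonneg[OF comp_type_in_compositions[OF assms(2)]] assms(3) by simp
  show "0 \<le> \<gamma> (comp_type G)"
    if "G \<in> {G. G \<in> set_compositions n \<and> blocks_within (blocks (P @ s # t # Q)) G}" for G
    using that by (intro nonneg comp_type_in_compositions) blast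
qed (simp add: finite_set_compositions, use blocks_within_bracket in blast)

text \<open>A set composition that splits a block contributes zero by primitivity. Any other one of
  nonzero coefficient sorts the factors, and modulo lower weight this sorting is invisible to
  \<open>h\<close>.\<close>

lemma evs_face_op:
  assumes P: "P \<in> forests n" and h: "vanishes_below (wt P) h"
  shows "evs P (face_op n \<gamma> h) = wt P * evs P h"
proof -
  have eq: "\<gamma> (comp_type G) * evs P (\<lambda>w. h (sort_key (block_index G) w)) =
      (if blocks_within (blocks P) G then \<gamma> (comp_type G) * evs P h else 0)"
    if G: "G \<in> set_compositions n" for G
  proof (cases "blocks_within (blocks P) G")
    case False
    then obtain t where "t \<in> set P" "\<not> monochromatic (block_index G) t"
      using blocks_within_iff_monochromatic[OF P G] by blast
    then have "evs P (\<lambda>w. h (sort_key (block_index G) w)) = 0"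
      by (rule evs_not_monochromatic[OF adjacent_invariant_sort_key])
    then show ?thesis
      using False by simp
  next
    case True
    then have mono: "\<forall>t\<in>set P. monochromatic (block_index G) t"
      using blocks_within_iff_monochromatic[OF P G] by blast
    \<comment> \<open>Sorting exchanges only factors lying in different blocks of \<open>G\<close>;
      by \<open>weight_bracket_less\<close> each such exchange costs a bracket of smaller weight, on
      which \<open>h\<close> vanishes.\<close>
    have "evs (sort_key (colour (block_index G)) P) h = evs P h" if "\<gamma> (comp_type G) \<noteq> 0"
    proof (rule sort_key_invariant)
      fix us s t vs
      assume m: "mset (us @ s # t # vs) = mset P"
        and c: "colour (block_index G) s \<noteq> colour (block_index G) t"
      have f: "us @ s # t # vs \<in> forests n"
        using forests_mset[OF m P] .
      have "blocks_within (blocks (us @ s # t # vs)) G"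
        using True mset_eq_setD[OF m] unfolding blocks_within_def set_map by metis
      from weight_bracket_less[OF f G that this c] have "wt (us @ Bracket s t # vs) < wt P"
        unfolding weight_mset[OF m] .
      then have "evs (us @ Bracket s t # vs) h = 0"
        using h forests_bracket[OF f] by (simp add: vanishes_below_def)
      then show "evs (us @ s # t # vs) h = evs (us @ t # s # vs) h"
        by (simp add: evs_adjacent_swap[of us s t vs])
    qed
    then show ?thesis
      using True by (cases "\<gamma> (comp_type G) = 0") (simp_all add: evs_sort_key[OF mono])
  qed
  have "evs P (face_op n \<gamma> h) =
      (\<Sum>G\<in>set_compositions n. \<gamma> (comp_type G) * evs P (\<lambda>w. h (sort_key (block_index G) w)))"
    unfolding face_op_def evs_sum evs_cmult ..
  also have "\<dots> = (\<Sum>G\<in>set_compositions n. if blocks_within (blocks P) G then \<gamma> (comp_type G) * evs P h else 0)"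
    by (intro sum.cong refl eq)
  also have "\<dots> = wt P * evs P h"
    by (simp add: coarse_weight_def sum_distrib_right finite_set_compositions sum.inter_filter[symmetric])
  finally show ?thesis .
qed

lemma evs_rev_face_op:
  assumes P: "P \<in> forests n" and h: "vanishes_below (wt P) h"
  shows "evs P (rev_face_op n \<gamma> h) = (- 1) ^ (n - length P) * wt P * evs (rev P) h"
proof -
  have r: "rev P \<in> forests n" "wt (rev P) = wt P"
    by (rule forests_mset[OF _ P]) (auto intro: weight_mset)
  \<comment> \<open>The exponent supplied by \<open>evs_rev\<close> is \<open>n + length P\<close>;
    its parity is that of the difference because a forest has at most \<open>n\<close>
    factors.\<close>
  have "(- 1 :: 'k) ^ (n + length P) = (- 1) ^ (n - length P)"
    using length_forest_le[OF P] by (intro minus_one_power_iff[THEN trans]) (auto simp: minus_one_power_iff)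
  then have "evs P (rev_face_op n \<gamma> h) = (- 1) ^ (n - length P) * evs (rev P) (face_op n \<gamma> h)"
    unfolding rev_face_op_def using evs_rev[of P "face_op n \<gamma> h"] length_letters_forest[OF P] by simp
  then show ?thesis
    using evs_face_op[OF r(1)] h r(2) by (simp add: mult.assoc)
qed

text \<open>The operator respects the filtration, so it can be applied twice when both signs occur
  in a layer.\<close>

lemma vanishes_below_rev_face_op:
  assumes "vanishes_below c h"
  shows "vanishes_below c (rev_face_op n \<gamma> h)"
  unfolding vanishes_below_def
proof (intro ballI impI)
  fix P
  assume P: "P \<in> forests n" "wt P < c"
  then have "vanishes_below (wt P) h"
    using assms by (auto simp: vanishes_below_def)
  moreover have "evs (rev P) h = 0"
    using assms forests_mset[of "rev P" P n] weight_mset[of "rev P" P] P by (simp add: vanishes_below_def)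
  ultimately show "evs P (rev_face_op n \<gamma> h) = 0"
    using evs_rev_face_op[OF P(1)] by simp
qed

text \<open>A bracket reduces the number of factors by one and so flips the sign. By
  \<open>sgn\<close> it cannot keep the weight, hence lowers it, and every adjacent exchange is free
  under \<open>h\<close>.\<close>

lemma evs_rev_eq:
  assumes P: "P \<in> forests n" and h: "vanishes_below (wt P) h"
    and sgn: "\<And>Q. \<lbrakk>Q \<in> forests n; wt Q = wt P\<rbrakk> \<Longrightarrow> (- 1 :: 'k) ^ (n - length Q) = (- 1) ^ (n - length P)"
  shows "evs (rev P) h = evs P h"
proof (rule rev_invariant)
  fix us s t vs
  assume m: "mset (us @ s # t # vs) = mset P"
  let ?Q = "us @ Bracket s t # vs"
  have Q: "?Q \<in> forests n"
    using forests_bracket[OF forests_mset[OF m P]] .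
  have "length P = Suc (length ?Q)"
    using mset_eq_length[OF m] by simp
  then have "n - length ?Q = Suc (n - length P)"
    using length_forest_le[OF P] by simp
  \<comment> \<open>In an ordered ring \<open>1\<close> and \<open>-1\<close> are different.\<close>
  then have "(- 1 :: 'k) ^ (n - length ?Q) \<noteq> (- 1) ^ (n - length P)"
    by (simp add: minus_one_power_iff)
  then have "wt ?Q \<noteq> wt P"
    using sgn[OF Q] by blast
  then have "wt ?Q < wt P"
    using weight_bracket_le[of us s t vs] unfolding weight_mset[OF m] by (rule le_neq_trans[rotated])
  then have "evs ?Q h = 0"
    using h Q by (simp add: vanishes_below_def)
  then show "evs (us @ s # t # vs) h = evs (us @ t # s # vs) h"
    by (simp add: evs_adjacent_swap[of us s t vs])
qed

text \<open>Values from different weights differ even up to sign, so deleting values of absolute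
  value \<open>c\<close> from the list keeps those of all lower layers.\<close>

lemma abs_nt_family: "\<bar>nt_family n \<gamma> F\<bar> = coarse_weight n \<gamma> F"
  using weight_nonneg[of F] by (simp add: nt_family_eq minus_one_power_iff)

text \<open>Induction on the weight, measured by the number of set compositions of smaller weight
  because the order of \<open>'k\<close> need not be well-founded. \<open>ks\<close> is arbitrary
  since lower layers are handled with a shortened list.\<close>

lemma evs_factors_eq_zero:
  assumes "P \<in> forests n"
    and "\<And>F. \<lbrakk>F \<in> set_compositions n; coarse_weight n \<gamma> F \<le> wt P\<rbrakk> \<Longrightarrow> nt_family n \<gamma> F \<in> set ks"
  shows "evs P (factors (rev_face_op n \<gamma>) ks f) = 0"
  using assms
proof (induction "card {F \<in> set_compositions n. coarse_weight n \<gamma> F < wt P}" arbitrary: P ks rule: less_induct)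
  case less
  let ?T = "rev_face_op n \<gamma>" and ?s = "(- 1 :: 'k) ^ (n - length P)"
  define c where "c = wt P"
  \<comment> \<open>The induction hypothesis for all lower layers at once: a list that retains their
    values annihilates them.\<close>
  have vanish: "vanishes_below c (factors ?T ls f)"
    if ls: "\<And>F. \<lbrakk>F \<in> set_compositions n; coarse_weight n \<gamma> F < c\<rbrakk> \<Longrightarrow> nt_family n \<gamma> F \<in> set ls" for ls
    unfolding vanishes_below_def
  proof (intro ballI impI)
    fix Q
    assume Q: "Q \<in> forests n" "wt Q < c"
    show "evs Q (factors ?T ls f) = 0"
    proof (rule less.hyps[OF _ Q(1)])
      show "card {F \<in> set_compositions n. coarse_weight n \<gamma> F < wt Q}
          < card {F \<in> set_compositions n. coarse_weight n \<gamma> F < wt P}"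
      proof (rule psubset_card_mono)
        have "blocks Q \<in> {F \<in> set_compositions n. coarse_weight n \<gamma> F < wt P}"
          using Q blocks_in_set_compositions by (simp add: c_def)
        then show "{F \<in> set_compositions n. coarse_weight n \<gamma> F < wt Q}
            \<subset> {F \<in> set_compositions n. coarse_weight n \<gamma> F < wt P}"
          using Q(2) by (auto simp: c_def)
      qed (simp add: finite_set_compositions)
      show "nt_family n \<gamma> F \<in> set ls" if "F \<in> set_compositions n" "coarse_weight n \<gamma> F \<le> wt Q" for F
        using that Q(2) by (intro ls) auto
    qed
  qed
  have nt: "nt_family n \<gamma> (blocks Q) = (- 1) ^ (n - length Q) * wt Q" for Q
    by (simp add: nt_family_eq)
  have in_ks: "nt_family n \<gamma> F \<in> set ks" if "F \<in> set_compositions n" "coarse_weight n \<gamma> F \<le> c" for F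
    using less.prems(2) that by (simp add: c_def)
  \<comment> \<open>The value of \<open>nt_family\<close> at the blocks of \<open>P\<close>, and the
    scalar by which the operator acts, up to reversal.\<close>
  define k where "k = ?s * c"
  have k: "k \<in> set ks" "\<bar>k\<bar> = c"
    using in_ks[OF blocks_in_set_compositions[OF less.prems(1)]] abs_nt_family[of "blocks P"]
    by (simp_all add: k_def c_def nt)
  have T: "evs P (?T h) = k * evs (rev P) h" if "vanishes_below c h" for h
    using evs_rev_face_op[OF less.prems(1)] that by (simp add: c_def k_def)
  show ?case
  proof (cases "c = 0 \<or> (\<forall>Q\<in>forests n. wt Q = c \<longrightarrow> (- 1 :: 'k) ^ (n - length Q) = ?s)")
    case True
    define h where "h = factors ?T (remove1 k ks) f"
    have h: "vanishes_below c h"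
      unfolding h_def
    proof (rule vanish)
      fix F
      assume F: "F \<in> set_compositions n" "coarse_weight n \<gamma> F < c"
      then have "nt_family n \<gamma> F \<noteq> k"
        using abs_nt_family[of F] k(2) by auto
      then show "nt_family n \<gamma> F \<in> set (remove1 k ks)"
        using in_ks F by simp
    qed
    \<comment> \<open>At weight zero both sides vanish; otherwise the layer has a single sign and
      reversal is invisible. Hence the one factor \<open>T - k\<close> suffices.\<close>
    have "k * evs (rev P) h = k * evs P h"
    proof (cases "c = 0")
      case False
      then have "evs (rev P) h = evs P h"
        using True h by (intro evs_rev_eq[OF less.prems(1)]) (simp_all add: c_def)
      then show ?thesis by simp
    qed (simp add: k_def)
    then show ?thesis
      using T[OF h] by (simp add: factors_remove1[OF k(1)] h_def[symmetric] evs_diff evs_cmult)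
  next
    case False
    then obtain Q where Q: "Q \<in> forests n" "wt Q = c" "(- 1 :: 'k) ^ (n - length Q) \<noteq> ?s" and c: "c \<noteq> 0"
      by blast
    \<comment> \<open>The opposite sign occurs at \<open>Q\<close>, so \<open>-k\<close> is also in
      the list. The two factors form \<open>T^2 - c^2\<close>, which annihilates the layer because
      reversing twice is the identity.\<close>
    define k' where "k' = - k"
    have "(- 1 :: 'k) ^ (n - length Q) = - ?s"
      using Q(3) by (auto simp: minus_one_power_iff split: if_splits)
    then have "nt_family n \<gamma> (blocks Q) = k'"
      by (simp add: nt Q(2) k_def k'_def)
    then have "k' \<in> set ks"
      using in_ks[OF blocks_in_set_compositions[OF Q(1)]] Q(2) by simp
    moreover have "k' \<noteq> k"
      using k(2) c by (auto simp: k'_def)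
    ultimately have k': "k' \<in> set (remove1 k ks)"
      by simp
    define h where "h = factors ?T (remove1 k' (remove1 k ks)) f"
    have h: "vanishes_below c h"
      unfolding h_def
    proof (rule vanish)
      fix F
      assume F: "F \<in> set_compositions n" "coarse_weight n \<gamma> F < c"
      then have "nt_family n \<gamma> F \<noteq> k" "nt_family n \<gamma> F \<noteq> k'"
        using abs_nt_family[of F] k(2) by (auto simp: k'_def)
      then show "nt_family n \<gamma> F \<in> set (remove1 k' (remove1 k ks))"
        using in_ks F by simp
    qed
    have r: "rev P \<in> forests n" "wt (rev P) = c"
      using forests_mset[of "rev P" P n] weight_mset[of "rev P" P] less.prems(1) by (simp_all add: c_def)
    have "evs P (?T (?T h)) = k * k * evs P h"
      using T[OF vanishes_below_rev_face_op[OF h]] evs_rev_face_op[OF r(1), of h] h r(2)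
      by (simp add: k_def mult.assoc)
    moreover have "factors ?T ks f = (\<lambda>w. ?T (?T h) w - k' * ?T h w - k * (?T h w - k' * h w))"
      unfolding factors_remove1[OF k(1)] factors.simps factors_remove1[OF k']
        h_def[symmetric] rev_face_op_diff_cmult ..
    ultimately show ?thesis
      using T[OF h] by (simp add: evs_diff evs_cmult k'_def algebra_simps)
  qed
qed

lemma evs_letters: "evs (map Letter w) f = f w"
  by (induction w arbitrary: f) simp_all

text \<open>A word is the product of its letters, hence itself a forest, and \<open>evs\<close> of
  that forest is evaluation at the word.\<close>

lemma factors_eq_zero:
  assumes "nt_family n \<gamma> ` set_compositions n \<subseteq> set ks" "distinct w" "set w = {1..n}"
  shows "factors (rev_face_op n \<gamma>) ks f w = 0"
proof -
  have "concat (map letters (map Letter w)) = w"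
    by (induction w) simp_all
  then have "map Letter w \<in> forests n"
    using assms(2,3) by (simp add: forests_def del: map_map)
  from evs_factors_eq_zero[OF this, of ks f] show ?thesis
    using assms(1) by (auto simp: evs_letters)
qed

end

section \<open>Descents and set compositions\<close>

primrec chunks :: "nat list \<Rightarrow> 'a list \<Rightarrow> 'a list list" where
  "chunks [] xs = []"
| "chunks (a # \<alpha>) xs = take a xs # chunks \<alpha> (drop a xs)"

lemma concat_chunks: "sum_list \<alpha> = length xs \<Longrightarrow> concat (chunks \<alpha> xs) = xs"
  by (induction \<alpha> arbitrary: xs) simp_all

lemma map_length_chunks: "sum_list \<alpha> = length xs \<Longrightarrow> map length (chunks \<alpha> xs) = \<alpha>"
  by (induction \<alpha> arbitrary: xs) simp_all

lemma chunks_concat: "chunks (map length yss) (concat yss) = yss"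
  by (induction yss) simp_all

text \<open>Positions are counted from 1 as in \<open>descents\<close>, list indices from 0: the
  entries compared are those numbered \<open>i\<close> and \<open>i + 1\<close>.\<close>

definition list_descents :: "nat list \<Rightarrow> nat set" where
  "list_descents v = {i \<in> {1..<length v}. v ! i < v ! (i - 1)}"

text \<open>The junction \<open>length x\<close> may or may not be a descent, so it appears in the
  upper bound only.\<close>

lemma list_descents_append:
  "list_descents (x @ y) \<subseteq> insert (length x) (list_descents x \<union> (+) (length x) ` list_descents y)"
  "list_descents x \<subseteq> list_descents (x @ y)"
  "(+) (length x) ` list_descents y \<subseteq> list_descents (x @ y)"
proof -
  show "list_descents (x @ y) \<subseteq> insert (length x) (list_descents x \<union> (+) (length x) ` list_descents y)"
  proof
    fix i
    assume i: "i \<in> list_descents (x @ y)"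
    show "i \<in> insert (length x) (list_descents x \<union> (+) (length x) ` list_descents y)"
    proof (cases "i \<le> length x")
      case True
      then have "i = length x \<or> i \<in> list_descents x"
        using i by (cases i) (auto simp: list_descents_def nth_append)
      then show ?thesis by blast
    next
      case False
      then obtain j where j: "i = length x + Suc j"
        by (metis add_Suc_right less_imp_Suc_add not_le)
      then have "Suc j \<in> list_descents y"
        using i by (simp add: list_descents_def nth_append)
      with j show ?thesis by blast
    qed
  qed
  show "list_descents x \<subseteq> list_descents (x @ y)"
  proof
    fix i
    assume "i \<in> list_descents x"
    then show "i \<in> list_descents (x @ y)"
      by (cases i) (simp_all add: list_descents_def nth_append)
  qed
  show "(+) (length x) ` list_descents y \<subseteq> list_descents (x @ y)"
  proof (rule image_subsetI)
    fix i
    assume "i \<in> list_descents y"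
    then show "length x + i \<in> list_descents (x @ y)"
      by (cases i) (simp_all add: list_descents_def nth_append)
  qed
qed

lemma list_descents_empty_iff: "list_descents v = {} \<longleftrightarrow> sorted v"
proof -
  have "list_descents v = {} \<longleftrightarrow> (\<forall>i. Suc i < length v \<longrightarrow> v ! i \<le> v ! Suc i)"
  proof
    assume *: "list_descents v = {}"
    show "\<forall>i. Suc i < length v \<longrightarrow> v ! i \<le> v ! Suc i"
    proof (intro allI impI)
      fix i
      assume "Suc i < length v"
      moreover have "Suc i \<notin> list_descents v"
        using * by simp
      ultimately show "v ! i \<le> v ! Suc i"
        by (simp add: list_descents_def)
    qed
  next
    assume *: "\<forall>i. Suc i < length v \<longrightarrow> v ! i \<le> v ! Suc i"
    have "i \<notin> list_descents v" for i
      using * by (cases i) (auto simp: list_descents_def not_less)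
    then show "list_descents v = {}"
      by blast
  qed
  then show ?thesis
    by (simp add: sorted_iff_nth_Suc)
qed

text \<open>The full sum is excluded from \<open>partial_sums\<close>, so a single part yields no
  cut.\<close>

lemma partial_sums_Cons:
  "partial_sums (a # \<alpha>) = (if \<alpha> = [] then {} else insert a ((+) a ` partial_sums \<alpha>))"
proof -
  have "i \<in> partial_sums (a # \<alpha>) \<longleftrightarrow> \<alpha> \<noteq> [] \<and> (i = a \<or> i \<in> (+) a ` partial_sums \<alpha>)" for i
  proof
    assume "i \<in> partial_sums (a # \<alpha>)"
    then obtain j where j: "i = sum_list (take (Suc j) (a # \<alpha>))" "j < length \<alpha>"
      unfolding partial_sums_def by (auto dest!: Suc_le_D)
    show "\<alpha> \<noteq> [] \<and> (i = a \<or> i \<in> (+) a ` partial_sums \<alpha>)"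
    proof (cases j)
      case 0
      then show ?thesis using j by auto
    next
      case (Suc l)
      then have "sum_list (take j \<alpha>) \<in> partial_sums \<alpha>"
        using j(2) unfolding partial_sums_def by (intro CollectI exI[of _ j]) simp
      then show ?thesis using j by auto
    qed
  next
    assume "\<alpha> \<noteq> [] \<and> (i = a \<or> i \<in> (+) a ` partial_sums \<alpha>)"
    then consider "\<alpha> \<noteq> []" "i = a" | j where "i = a + sum_list (take j \<alpha>)" "1 \<le> j" "j < length \<alpha>"
      by (auto simp: partial_sums_def)
    then show "i \<in> partial_sums (a # \<alpha>)"
    proof cases
      case 1
      then show ?thesis unfolding partial_sums_def by (intro CollectI exI[of _ 1]) simp
    next
      case (2 j)
      then show ?thesis unfolding partial_sums_def by (intro CollectI exI[of _ "Suc j"]) simp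
    qed
  qed
  then show ?thesis by auto
qed

lemma partial_sums_Nil [simp]: "partial_sums [] = {}"
  by (simp add: partial_sums_def)

text \<open>The partial sums are the cuts between chunks; descents confined to the cuts mean that
  every chunk increases.\<close>

lemma list_descents_subset_iff:
  assumes "sum_list \<alpha> = length v" "\<forall>a\<in>set \<alpha>. 0 < a"
  shows "list_descents v \<subseteq> partial_sums \<alpha> \<longleftrightarrow> (\<forall>ys\<in>set (chunks \<alpha> v). sorted ys)"
  using assms
proof (induction \<alpha> arbitrary: v)
  case Nil
  then show ?case by (simp add: list_descents_def)
next
  case (Cons a \<alpha>)
  define x y where "x = take a v" and "y = drop a v"
  have v: "v = x @ y" and x: "length x = a" and y: "sum_list \<alpha> = length y"
    using Cons.prems by (auto simp: x_def y_def)
  have ch: "chunks (a # \<alpha>) v = x # chunks \<alpha> y"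
    by (simp add: x_def y_def)
  have "list_descents v \<subseteq> partial_sums (a # \<alpha>) \<longleftrightarrow> list_descents x = {} \<and> list_descents y \<subseteq> partial_sums \<alpha>"
  proof
    assume sub: "list_descents v \<subseteq> partial_sums (a # \<alpha>)"
    have "i \<notin> list_descents x" for i
    proof
      assume i: "i \<in> list_descents x"
      then have "i < a" by (simp add: list_descents_def x)
      moreover have "i \<in> partial_sums (a # \<alpha>)"
        using i sub list_descents_append(2)[of x y] by (auto simp: v)
      ultimately show False
        by (auto simp: partial_sums_Cons split: if_splits)
    qed
    moreover have "i \<in> partial_sums \<alpha>" if i: "i \<in> list_descents y" for i
    proof -
      \<comment> \<open>This separates \<open>a + i\<close> from the cut \<open>a\<close>
        itself.\<close>
      have "0 < i" using i by (simp add: list_descents_def)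
      have "a + i \<in> (+) (length x) ` list_descents y"
        using i x by simp
      then have "a + i \<in> partial_sums (a # \<alpha>)"
        using sub list_descents_append(3)[of x y] unfolding v by blast
      then show ?thesis
        using \<open>0 < i\<close> by (auto simp: partial_sums_Cons split: if_splits)
    qed
    ultimately show "list_descents x = {} \<and> list_descents y \<subseteq> partial_sums \<alpha>"
      by blast
  next
    assume *: "list_descents x = {} \<and> list_descents y \<subseteq> partial_sums \<alpha>"
    show "list_descents v \<subseteq> partial_sums (a # \<alpha>)"
    proof (cases "\<alpha> = []")
      case True
      then show ?thesis using * y by (simp add: v)
    next
      case False
      then show ?thesis
        using * list_descents_append(1)[of x y] x unfolding v partial_sums_Cons by auto
    qed
  qed
  then show ?case
    using Cons.IH[OF y] Cons.prems(2) by (simp add: ch list_descents_empty_iff del: chunks.simps)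
qed

section \<open>Stable sorting by blocks\<close>

text \<open>A bucket sort: the result has the same multiset, increasing keys, and an unchanged
  subword for each key, which characterises the stable sort.\<close>

lemma concat_filter_eq_sort_key:
  assumes "\<And>x. x \<in> set w \<Longrightarrow> \<chi> x < k"
  shows "concat (map (\<lambda>i. filter (\<lambda>x. \<chi> x = i) w) [0..<k]) = sort_key \<chi> w"
proof -
  let ?c = "\<lambda>k. concat (map (\<lambda>i. filter (\<lambda>x. \<chi> x = i) w) [0..<k])"
  have set: "set (?c k) = {x \<in> set w. \<chi> x < k}" for k
    by auto
  have sorted: "sorted (map \<chi> (?c k))" for k
  proof (induction k)
    case (Suc k)
    have "sorted (map \<chi> (filter (\<lambda>x. \<chi> x = k) w))"
      by (induction w) auto
    then show ?case
      using Suc by (auto simp: sorted_append)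
  qed simp
  have filter: "filter (\<lambda>x. \<chi> x = j) (?c k) = (if j < k then filter (\<lambda>x. \<chi> x = j) w else [])" for j k
  proof (induction k)
    case (Suc k)
    have "filter (\<lambda>x. \<chi> x = j) (filter (\<lambda>x. \<chi> x = k) w) = (if j = k then filter (\<lambda>x. \<chi> x = j) w else [])"
      by (induction w) auto
    then show ?case
      using Suc by (auto simp: less_Suc_eq)
  qed simp
  have ms: "mset (?c k) = mset (filter (\<lambda>x. \<chi> x < k) w)" for k
  proof (induction k)
    case (Suc k)
    have "mset (filter (\<lambda>x. \<chi> x < Suc k) w) = mset (filter (\<lambda>x. \<chi> x < k) w) + mset (filter (\<lambda>x. \<chi> x = k) w)"
      by (induction w) auto
    then show ?case
      using Suc by simp
  qed simp
  have "filter (\<lambda>x. \<chi> x < k) w = w"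
    using assms by (simp add: filter_id_conv)
  then have m: "mset (?c k) = mset w"
    using ms[of k] by (simp only:)
  show ?thesis
  proof (rule properties_for_sort_key[symmetric])
    fix x
    assume "x \<in> set (?c k)"
    then have "\<chi> x < k"
      using set by blast
    then show "filter (\<lambda>y. \<chi> x = \<chi> y) (?c k) = filter (\<lambda>y. \<chi> x = \<chi> y) w"
      using filter[of "\<chi> x" k] by (simp add: eq_commute[of "\<chi> x"])
  qed (use m sorted in simp_all)
qed

lemma concat_filter_blocks:
  assumes "G \<in> set_compositions n" "set w \<subseteq> {1..n}"
  shows "concat (map (\<lambda>B. filter (\<lambda>a. a \<in> B) w) G) = sort_key (block_index G) w"
proof -
  have iff: "a \<in> G ! i \<longleftrightarrow> block_index G a = i" if "a \<in> set w" "i < length G" for a i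
    using block_index_eq[OF assms(1) that(2), of a] block_index_nth(2)[OF assms(1), of a] that assms(2) by blast
  have "map (\<lambda>B. filter (\<lambda>a. a \<in> B) w) G = map (\<lambda>i. filter (\<lambda>a. a \<in> G ! i) w) [0..<length G]"
    by (rule nth_equalityI) simp_all
  also have "\<dots> = map (\<lambda>i. filter (\<lambda>a. block_index G a = i) w) [0..<length G]"
    using iff by (intro map_cong filter_cong refl) simp_all
  also have "concat \<dots> = sort_key (block_index G) w"
    using assms(2) by (intro concat_filter_eq_sort_key block_index_nth(1)[OF assms(1)]) blast
  finally show ?thesis .
qed

section \<open>Permutations and their words\<close>

definition one_line :: "nat \<Rightarrow> (nat \<Rightarrow> nat) \<Rightarrow> nat list" where
  "one_line n u = map u [1..<Suc n]"

definition perm_of_word :: "nat \<Rightarrow> nat list \<Rightarrow> nat \<Rightarrow> nat" where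
  "perm_of_word n v i = (if i \<in> {1..n} then v ! (i - 1) else i)"

lemma length_one_line [simp]: "length (one_line n u) = n"
  by (simp add: one_line_def)

lemma one_line_comp: "one_line n (c \<circ> u) = map c (one_line n u)"
  by (simp add: one_line_def)

lemma nth_one_line: "i < n \<Longrightarrow> one_line n u ! i = u (Suc i)"
  by (simp add: one_line_def del: upt_Suc)

lemma one_line_permutes:
  assumes "u permutes {1..n}"
  shows "distinct (one_line n u)" "set (one_line n u) = {1..n}"
proof -
  have I: "set [1..<Suc n] = {1..n}"
    by auto
  show "set (one_line n u) = {1..n}"
    unfolding one_line_def set_map I by (rule permutes_image[OF assms])
  show "distinct (one_line n u)"
    unfolding one_line_def distinct_map using permutes_inj_on[OF assms] by simp
qed

lemma one_line_perm_of_word: "length v = n \<Longrightarrow> one_line n (perm_of_word n v) = v"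
  by (rule nth_equalityI) (simp_all add: nth_one_line perm_of_word_def)

lemma perm_of_word_permutes:
  assumes "distinct v" "set v = {1..n}"
  shows "perm_of_word n v permutes {1..n}"
proof (rule bij_imp_permutes)
  have len: "length v = n"
    using distinct_card[OF assms(1)] assms(2) by simp
  have "set [1..<Suc n] = {1..n}"
    by auto
  then show "bij_betw (perm_of_word n v) {1..n} {1..n}"
    using one_line_perm_of_word[OF len] assms unfolding one_line_def bij_betw_def
    by (metis distinct_map set_map)
qed (simp only: perm_of_word_def if_False)

lemma perm_of_word_one_line:
  assumes "u permutes {1..n}"
  shows "perm_of_word n (one_line n u) = u"
proof
  fix i
  show "perm_of_word n (one_line n u) i = u i"
    using permutes_not_in[OF assms, of i] by (auto simp: perm_of_word_def nth_one_line)
qed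

lemma descents_eq_list_descents: "descents n u = list_descents (one_line n u)"
  unfolding descents_def list_descents_def by (auto simp: nth_one_line)

lemma permutes_preimage_list:
  assumes "c permutes {1..n}" "B \<subseteq> {1..n}"
  shows "c ` set (filter (\<lambda>i. c i \<in> B) [1..<Suc n]) = B" "length (filter (\<lambda>i. c i \<in> B) [1..<Suc n]) = card B"
proof -
  let ?l = "filter (\<lambda>i. c i \<in> B) [1..<Suc n]"
  have set: "set ?l = {i \<in> {1..n}. c i \<in> B}"
    by auto
  show im: "c ` set ?l = B"
    unfolding set
  proof
    show "B \<subseteq> c ` {i \<in> {1..n}. c i \<in> B}"
    proof
      fix b
      assume b: "b \<in> B"
      then have "b \<in> c ` {1..n}"
        using permutes_image[OF assms(1)] assms(2) by blast
      then show "b \<in> c ` {i \<in> {1..n}. c i \<in> B}"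
        using b by blast
    qed
  qed blast
  have "card (c ` set ?l) = card (set ?l)"
    by (rule card_image[OF permutes_inj_on[OF assms(1)]])
  then show "length ?l = card B"
    unfolding im using distinct_card[of ?l] by simp
qed

text \<open>The permutations with descents in \<open>D(\<alpha>)\<close> correspond to the set compositions of type \<open>\<alpha>\<close>:
  cut the one-line notation into chunks of sizes \<open>\<alpha>\<close> and forget the order within each chunk.\<close>

lemma sum_descents_eq_sum_faces:
  assumes c: "c permutes {1..n}" and \<alpha>: "\<alpha> \<in> compositions n"
  shows "(\<Sum>u | u permutes {1..n} \<and> descents n u \<subseteq> partial_sums \<alpha>. f (one_line n (c \<circ> u))) =
    (\<Sum>G | G \<in> set_compositions n \<and> comp_type G = \<alpha>. f (sort_key (block_index G) (one_line n c)))"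
proof -
  \<comment> \<open>\<open>pre B\<close> lists in increasing order the positions at which
    \<open>c\<close> takes values in \<open>B\<close>. Thus \<open>word\<close> rebuilds the
    one-line notation of \<open>u\<close> from a set composition of the values of \<open>c\<close>,
    and \<open>face\<close> is the inverse passage.\<close>
  define pre where "pre = (\<lambda>B. filter (\<lambda>i. c i \<in> B) [1..<Suc n])"
  define word where "word = (\<lambda>G. concat (map pre G))"
  define face where "face = (\<lambda>u. map (\<lambda>ys. c ` set ys) (chunks \<alpha> (one_line n u)))"
  have sum\<alpha>: "sum_list \<alpha> = n" and pos: "\<forall>a\<in>set \<alpha>. 0 < a"
    using \<alpha> by (simp_all add: compositions_def)
  have word: "distinct (word G)" "set (word G) = {1..n}" "chunks \<alpha> (word G) = map pre G"
    "map (\<lambda>ys. c ` set ys) (map pre G) = G" "map c (word G) = sort_key (block_index G) (one_line n c)"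
    if G: "G \<in> set_compositions n" "comp_type G = \<alpha>" for G
  proof -
    have sub: "B \<subseteq> {1..n}" if "B \<in> set G" for B
      using that G(1) by (auto simp: set_compositions_def)
    show "map (\<lambda>ys. c ` set ys) (map pre G) = G"
      unfolding map_map by (rule map_idI) (simp only: comp_def pre_def permutes_preimage_list(1)[OF c sub])
    have "map length (map pre G) = \<alpha>"
      unfolding G(2)[symmetric] comp_type_def map_map
      by (intro map_cong refl) (simp only: comp_def pre_def permutes_preimage_list(2)[OF c sub])
    then show "chunks \<alpha> (word G) = map pre G"
      unfolding word_def using chunks_concat[of "map pre G"] by simp
    have "map c (pre B) = filter (\<lambda>a. a \<in> B) (one_line n c)" for B
      by (simp add: pre_def one_line_def filter_map comp_def del: upt_Suc)
    then have "map c (word G) = concat (map (\<lambda>B. filter (\<lambda>a. a \<in> B) (one_line n c)) G)"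
      by (simp add: word_def map_concat comp_def)
    also have "\<dots> = sort_key (block_index G) (one_line n c)"
      using one_line_permutes(2)[OF c] by (intro concat_filter_blocks[OF G(1)]) simp
    finally show eq: "map c (word G) = sort_key (block_index G) (one_line n c)" .
    have "distinct (map c (word G))" "set (map c (word G)) = {1..n}"
      unfolding eq using one_line_permutes[OF c] by simp_all
    then have "distinct (word G)" "c ` set (word G) = c ` {1..n}"
      unfolding distinct_map set_map permutes_image[OF c] by simp_all
    then show "distinct (word G)" "set (word G) = {1..n}"
      unfolding inj_image_eq_iff[OF permutes_inj[OF c]] .
  qed
  have perm: "face u \<in> set_compositions n" "comp_type (face u) = \<alpha>" "word (face u) = one_line n u"
    if u: "u permutes {1..n}" "descents n u \<subseteq> partial_sums \<alpha>" for u
  proof -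
    let ?ys = "chunks \<alpha> (one_line n u)"
    have cc: "concat ?ys = one_line n u" and ll: "map length ?ys = \<alpha>"
      using sum\<alpha> by (simp_all add: concat_chunks map_length_chunks)
    have sorted: "sorted ys" if "ys \<in> set ?ys" for ys
      using list_descents_subset_iff[of \<alpha> "one_line n u"] that u(2) sum\<alpha> pos
      by (simp add: descents_eq_list_descents)
    have "distinct (concat ?ys)" "set (concat ?ys) = {1..n}"
      unfolding cc by (rule one_line_permutes[OF u(1)])+
    then have dist: "distinct ys" and sub: "set ys \<subseteq> {1..n}" if "ys \<in> set ?ys" for ys
      using that by (auto simp: distinct_concat_iff)
    have F: "face u = map set (map (map c) ?ys)"
      by (simp add: face_def)
    have cc': "concat (map (map c) ?ys) = one_line n (c \<circ> u)"
      by (simp add: map_concat[symmetric] cc one_line_comp)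
    have "[] \<notin> set (map (map c) ?ys)"
    proof
      assume "[] \<in> set (map (map c) ?ys)"
      then have "[] \<in> set ?ys" by auto
      then have "0 \<in> set (map length ?ys)" by force
      then show False unfolding ll using pos by blast
    qed
    then show "face u \<in> set_compositions n"
      unfolding F using one_line_permutes[OF permutes_compose[OF u(1) c]] cc'
      by (intro set_compositions_of_lists) simp_all
    have "card (c ` set ys) = length ys" if "ys \<in> set ?ys" for ys
      using card_image[OF permutes_inj_on[OF c]] distinct_card[OF dist[OF that]] by simp
    then have "comp_type (face u) = map length ?ys"
      by (simp add: comp_type_def face_def)
    then show "comp_type (face u) = \<alpha>"
      using ll by simp
    \<comment> \<open>The descent condition makes each chunk increasing, so its set determines
      it.\<close>
    have "pre (c ` set ys) = ys" if "ys \<in> set ?ys" for ys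
    proof (rule sorted_distinct_set_unique)
      show "set (pre (c ` set ys)) = set ys"
        using sub[OF that] by (auto simp: pre_def inj_image_mem_iff[OF permutes_inj[OF c]])
      show "sorted (pre (c ` set ys))" "distinct (pre (c ` set ys))"
        by (simp_all add: pre_def sorted_wrt_filter del: upt_Suc)
    qed (use that sorted dist in auto)
    then have "map pre (face u) = ?ys"
      unfolding face_def map_map by (intro map_idI) simp
    then show "word (face u) = one_line n u"
      by (simp add: word_def cc)
  qed
  show ?thesis
  proof (rule sum.reindex_bij_witness[where i = "\<lambda>G. perm_of_word n (word G)" and j = face])
    fix u
    assume "u \<in> {u. u permutes {1..n} \<and> descents n u \<subseteq> partial_sums \<alpha>}"
    then have u: "u permutes {1..n}" "descents n u \<subseteq> partial_sums \<alpha>"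
      by simp_all
    show "perm_of_word n (word (face u)) = u"
      using perm(3)[OF u] perm_of_word_one_line[OF u(1)] by simp
    show "face u \<in> {G. G \<in> set_compositions n \<and> comp_type G = \<alpha>}"
      using perm[OF u] by simp
    show "f (sort_key (block_index (face u)) (one_line n c)) = f (one_line n (c \<circ> u))"
      using word(5)[OF perm(1,2)[OF u]] perm(3)[OF u] by (simp add: one_line_comp)
  next
    fix G
    assume "G \<in> {G. G \<in> set_compositions n \<and> comp_type G = \<alpha>}"
    then have G: "G \<in> set_compositions n" "comp_type G = \<alpha>"
      by simp_all
    have len: "length (word G) = n"
      using distinct_card[OF word(1)[OF G]] word(2)[OF G] by simp
    then show "face (perm_of_word n (word G)) = G"
      using word(3,4)[OF G] by (simp add: face_def one_line_perm_of_word del: map_map)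
    have "\<forall>ys\<in>set (chunks \<alpha> (word G)). sorted ys"
      using word(3)[OF G] by (auto simp: pre_def sorted_wrt_filter simp del: upt_Suc)
    then have "descents n (perm_of_word n (word G)) \<subseteq> partial_sums \<alpha>"
      using list_descents_subset_iff[of \<alpha> "word G"] sum\<alpha> len pos
      by (simp add: descents_eq_list_descents one_line_perm_of_word)
    then show "perm_of_word n (word G) \<in> {u. u permutes {1..n} \<and> descents n u \<subseteq> partial_sums \<alpha>}"
      using perm_of_word_permutes[OF word(1,2)[OF G]] by simp
  qed
qed

section \<open>The group algebra acting on words\<close>

text \<open>
  The operator \<open>T\<close> on functions of words is the transpose of right multiplication by \<open>x\<close>; this makes
  \<open>x \<mapsto> T\<close> multiplicative rather than anti-multiplicative.
\<close>

definition represents :: "nat \<Rightarrow> ((nat \<Rightarrow> nat) \<Rightarrow> 'k::comm_ring_1) \<Rightarrow> ((nat list \<Rightarrow> 'k) \<Rightarrow> nat list \<Rightarrow> 'k) \<Rightarrow> bool" where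
  "represents n x T \<longleftrightarrow> (\<forall>f c. c permutes {1..n} \<longrightarrow>
     (\<Sum>u | u permutes {1..n}. x u * f (one_line n (c \<circ> u))) = T f (one_line n c))"

lemma representsI:
  assumes "\<And>f c. c permutes {1..n} \<Longrightarrow> (\<Sum>u | u permutes {1..n}. x u * f (one_line n (c \<circ> u))) = T f (one_line n c)"
  shows "represents n x T"
  using assms by (simp add: represents_def)

lemma representsD:
  assumes "represents n x T" "c permutes {1..n}"
  shows "(\<Sum>u | u permutes {1..n}. x u * f (one_line n (c \<circ> u))) = T f (one_line n c)"
  using assms by (simp add: represents_def)

lemma finite_permutes_interval: "finite {u. u permutes {1..n::nat}}"
  by (simp add: finite_permutations)

lemma carrier_sym_group_eq: "carrier (sym_group n) = {u. u permutes {1..n}}"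
  by (simp add: sym_group_def)

text \<open>With the product expanded over pairs \<open>(u, v)\<close>, the sum over
  \<open>v\<close> is \<open>U f\<close> at the word of \<open>c \<circ> u\<close>; the sum over
  \<open>u\<close> then applies \<open>T\<close>.\<close>

lemma represents_mult:
  assumes "represents n x T" "represents n y U"
  shows "represents n (x \<otimes>\<^bsub>sym_group_algebra n\<^esub> y) (\<lambda>f. T (U f))"
proof (rule representsI)
  fix f :: "nat list \<Rightarrow> 'a" and c
  assume c: "c permutes {1..n}"
  let ?S = "{u. u permutes {1..n}}"
  have clo: "u \<circ> v \<in> ?S" if "u \<in> ?S" "v \<in> ?S" for u v
    using that by (simp add: permutes_compose)
  have "(\<Sum>w\<in>?S. (x \<otimes>\<^bsub>sym_group_algebra n\<^esub> y) w * f (one_line n (c \<circ> w))) =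
      (\<Sum>w\<in>?S. \<Sum>u\<in>?S. \<Sum>v\<in>?S. if u \<circ> v = w then x u * y v * f (one_line n (c \<circ> w)) else 0)"
    unfolding sym_group_algebra_mult carrier_sym_group_eq sum_distrib_right
    by (intro sum.cong refl) auto
  also have "\<dots> = (\<Sum>u\<in>?S. \<Sum>v\<in>?S. \<Sum>w\<in>?S. if u \<circ> v = w then x u * y v * f (one_line n (c \<circ> w)) else 0)"
    by (subst sum.swap) (intro sum.cong refl sum.swap)
  also have "\<dots> = (\<Sum>u\<in>?S. \<Sum>v\<in>?S. x u * y v * f (one_line n (c \<circ> (u \<circ> v))))"
    using clo by (intro sum.cong refl) (simp add: finite_permutations)
  also have "\<dots> = (\<Sum>u\<in>?S. x u * (\<Sum>v\<in>?S. y v * f (one_line n (c \<circ> u \<circ> v))))"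
    by (simp add: sum_distrib_left mult.assoc comp_assoc)
  also have "\<dots> = (\<Sum>u\<in>?S. x u * U f (one_line n (c \<circ> u)))"
    by (intro sum.cong refl arg_cong2[where f = "(*)"] representsD[OF assms(2) permutes_compose[OF _ c]]) simp
  also have "\<dots> = T (U f) (one_line n c)"
    by (rule representsD[OF assms(1) c])
  finally show "(\<Sum>w\<in>?S. (x \<otimes>\<^bsub>sym_group_algebra n\<^esub> y) w * f (one_line n (c \<circ> w))) = T (U f) (one_line n c)" .
qed

lemma represents_one: "represents n \<one>\<^bsub>sym_group_algebra n\<^esub> (\<lambda>f. f)"
proof (rule representsI)
  fix f :: "nat list \<Rightarrow> 'a" and c
  have "(\<Sum>u | u permutes {1..n}. \<one>\<^bsub>sym_group_algebra n\<^esub> u * f (one_line n (c \<circ> u))) =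
      (\<Sum>u | u permutes {1..n}. if u = id then f (one_line n (c \<circ> u)) else 0)"
    by (intro sum.cong refl) (simp add: sym_group_algebra_def sym_group_one)
  then show "(\<Sum>u | u permutes {1..n}. \<one>\<^bsub>sym_group_algebra n\<^esub> u * f (one_line n (c \<circ> u))) = f (one_line n c)"
    by (simp add: finite_permutations permutes_id)
qed

lemma scalar_elt_carrier: "scalar_elt n k \<in> carrier (sym_group_algebra n)"
  by (auto simp: sym_group_algebra_def scalar_elt_def sym_group_one carrier_sym_group_eq permutes_id)

lemma minus_scalar_elt:
  "x \<ominus>\<^bsub>sym_group_algebra n\<^esub> scalar_elt n k = (\<lambda>w. x w - k * \<one>\<^bsub>sym_group_algebra n\<^esub> w)"
proof -
  interpret A: ring "sym_group_algebra n :: ((nat \<Rightarrow> nat) \<Rightarrow> 'a) ring"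
    by (rule ring_sym_group_algebra)
  have "\<ominus>\<^bsub>sym_group_algebra n\<^esub> scalar_elt n k = scalar_elt n (- k)"
    by (rule A.minus_equality)
      (simp_all add: scalar_elt_carrier, simp add: sym_group_algebra_def scalar_elt_def)
  then show ?thesis
    by (simp add: a_minus_def) (simp add: sym_group_algebra_def scalar_elt_def)
qed

lemma represents_minus_scalar:
  assumes "represents n x T"
  shows "represents n (x \<ominus>\<^bsub>sym_group_algebra n\<^esub> scalar_elt n k) (\<lambda>f w. T f w - k * f w)"
proof (rule representsI)
  fix f :: "nat list \<Rightarrow> 'a" and c
  assume c: "c permutes {1..n}"
  show "(\<Sum>u | u permutes {1..n}. (x \<ominus>\<^bsub>sym_group_algebra n\<^esub> scalar_elt n k) u * f (one_line n (c \<circ> u))) =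
      T f (one_line n c) - k * f (one_line n c)"
    unfolding minus_scalar_elt left_diff_distrib sum_subtractf representsD[OF assms c] mult.assoc
      sum_distrib_left[symmetric] representsD[OF represents_one c] ..
qed

lemma represents_list_prod:
  assumes "represents n x T"
  shows "represents n (list_prod (sym_group_algebra n) (map (\<lambda>k. x \<ominus>\<^bsub>sym_group_algebra n\<^esub> scalar_elt n k) ks))
    (factors T ks)"
proof (induction ks)
  case Nil
  have "factors T [] = (\<lambda>f. f)" by (rule ext) simp
  then show ?case using represents_one by (simp add: list_prod_def)
next
  case (Cons k ks)
  have "factors T (k # ks) = (\<lambda>f w. T (factors T ks f) w - k * factors T ks f w)"
    by (intro ext) simp
  then show ?case
    using represents_mult[OF represents_minus_scalar[OF assms, of k] Cons] by (simp add: list_prod_def)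
qed

lemma list_prod_carrier:
  assumes "x \<in> carrier (sym_group_algebra n)"
  shows "list_prod (sym_group_algebra n) (map (\<lambda>k. x \<ominus>\<^bsub>sym_group_algebra n\<^esub> scalar_elt n k) ks)
    \<in> carrier (sym_group_algebra n :: ((nat \<Rightarrow> nat) \<Rightarrow> 'k::comm_ring_1) ring)"
proof -
  interpret A: ring "sym_group_algebra n :: ((nat \<Rightarrow> nat) \<Rightarrow> 'k) ring"
    by (rule ring_sym_group_algebra)
  show ?thesis
    by (induction ks) (simp_all add: list_prod_def assms scalar_elt_carrier)
qed

text \<open>A permutation is determined by its word, so applying the operator to the indicator of
  the word of \<open>w\<close> and evaluating at the identity word reads off the coefficient of
  \<open>w\<close>.\<close>

lemma represents_zero:
  assumes "represents n x T" "x \<in> carrier (sym_group_algebra n)" "\<And>f. T f (one_line n id) = 0"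
  shows "x = \<zero>\<^bsub>sym_group_algebra n\<^esub>"
proof -
  have "x w = 0" for w
  proof (cases "w permutes {1..n}")
    case True
    have "(if one_line n u = one_line n w then 1 else 0 :: 'a) = (if u = w then 1 else 0)"
      if "u permutes {1..n}" for u
      using that True perm_of_word_one_line by metis
    then have "(\<Sum>u | u permutes {1..n}. x u * (if one_line n u = one_line n w then 1 else 0)) =
        (\<Sum>u | u permutes {1..n}. if u = w then x u else 0)"
      by (intro sum.cong refl) simp
    also have "\<dots> = x w"
      using True by (simp add: finite_permutations)
    finally show ?thesis
      using representsD[OF assms(1) permutes_id, of "\<lambda>v. if v = one_line n w then 1 else 0"] assms(3) by simp
  next
    case False
    then show ?thesis
      using assms(2) by (simp add: sym_group_algebra_def carrier_sym_group_eq)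
  qed
  then show ?thesis
    by (auto simp: sym_group_algebra_def)
qed

lemma longest_perm_permutes: "longest_perm n permutes {1..n}"
proof (rule bij_imp_permutes)
  show "bij_betw (longest_perm n) {1..n} {1..n}"
    by (rule bij_betwI[where g = "longest_perm n"]) (auto simp: longest_perm_def)
qed (simp only: longest_perm_def if_False)

lemma one_line_longest_perm: "one_line n (c \<circ> longest_perm n) = rev (one_line n c)"
  by (rule nth_equalityI) (auto simp: nth_one_line rev_nth longest_perm_def Suc_diff_Suc)

lemma represents_longest_perm: "represents n (basis_elt (longest_perm n)) (\<lambda>f w. f (rev w))"
proof (rule representsI)
  fix f :: "nat list \<Rightarrow> 'a" and c
  have "(\<Sum>u | u permutes {1..n}. basis_elt (longest_perm n) u * f (one_line n (c \<circ> u))) =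
      (\<Sum>u | u permutes {1..n}. if u = longest_perm n then f (one_line n (c \<circ> u)) else 0)"
    by (intro sum.cong refl) (simp add: basis_elt_def)
  then show "(\<Sum>u | u permutes {1..n}. basis_elt (longest_perm n) u * f (one_line n (c \<circ> u))) = f (rev (one_line n c))"
    using longest_perm_permutes[of n] by (simp add: finite_permutations one_line_longest_perm)
qed

lemma B_comp_eq: "B_comp n \<alpha> w = (if w permutes {1..n} \<and> descents n w \<subseteq> partial_sums \<alpha> then 1 else 0)"
proof -
  have "finite {u. u permutes {1..n} \<and> descents n u \<subseteq> partial_sums \<alpha>}"
    by (rule finite_subset[OF _ finite_permutes_interval[of n]]) blast
  then show ?thesis
    by (simp add: B_comp_def basis_elt_def carrier_sym_group_eq)
qed

lemma represents_B_family: "represents n (B_family n \<gamma>) (face_op n \<gamma>)"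
proof (rule representsI)
  fix f :: "nat list \<Rightarrow> 'a" and c
  assume c: "c permutes {1..n}"
  let ?S = "{u. u permutes {1..n}}" and ?w = "one_line n c"
  have "(\<Sum>u\<in>?S. B_family n \<gamma> u * f (one_line n (c \<circ> u))) =
      (\<Sum>u\<in>?S. \<Sum>\<alpha>\<in>compositions n. \<gamma> \<alpha> * (B_comp n \<alpha> u * f (one_line n (c \<circ> u))))"
    by (simp add: B_family_def sum_distrib_right mult.assoc)
  also have "\<dots> = (\<Sum>\<alpha>\<in>compositions n. \<gamma> \<alpha> * (\<Sum>u\<in>?S. B_comp n \<alpha> u * f (one_line n (c \<circ> u))))"
    by (subst sum.swap) (simp add: sum_distrib_left)
  also have "\<dots> = (\<Sum>\<alpha>\<in>compositions n. \<gamma> \<alpha> * (\<Sum>G | G \<in> set_compositions n \<and> comp_type G = \<alpha>. f (sort_key (block_index G) ?w)))"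
  proof (intro sum.cong refl arg_cong2[where f = "(*)"])
    fix \<alpha>
    assume \<alpha>: "\<alpha> \<in> compositions n"
    have "(\<Sum>u\<in>?S. B_comp n \<alpha> u * f (one_line n (c \<circ> u))) =
        (\<Sum>u\<in>?S. if descents n u \<subseteq> partial_sums \<alpha> then f (one_line n (c \<circ> u)) else 0)"
      by (intro sum.cong refl) (simp add: B_comp_eq)
    also have "\<dots> = (\<Sum>u | u \<in> ?S \<and> descents n u \<subseteq> partial_sums \<alpha>. f (one_line n (c \<circ> u)))"
      by (rule sum.inter_filter[symmetric]) (rule finite_permutes_interval)
    also have "\<dots> = (\<Sum>G | G \<in> set_compositions n \<and> comp_type G = \<alpha>. f (sort_key (block_index G) ?w))"
      using sum_descents_eq_sum_faces[OF c \<alpha>] by simp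
    finally show "(\<Sum>u\<in>?S. B_comp n \<alpha> u * f (one_line n (c \<circ> u))) =
        (\<Sum>G | G \<in> set_compositions n \<and> comp_type G = \<alpha>. f (sort_key (block_index G) ?w))" .
  qed
  also have "\<dots> = (\<Sum>\<alpha>\<in>compositions n. \<Sum>G | G \<in> set_compositions n \<and> comp_type G = \<alpha>.
      \<gamma> (comp_type G) * f (sort_key (block_index G) ?w))"
    by (simp add: sum_distrib_left)
  also have "\<dots> = face_op n \<gamma> f ?w"
    unfolding face_op_def
    by (rule sum.group) (auto simp: finite_set_compositions finite_compositions comp_type_in_compositions)
  finally show "(\<Sum>u\<in>?S. B_family n \<gamma> u * f (one_line n (c \<circ> u))) = face_op n \<gamma> f ?w" .
qed

text \<open>\<open>B w0\<close> is the conjugate of \<open>w0 B\<close> by the involution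
  \<open>w0\<close>, so the second product reduces to the first.\<close>

lemma factors_face_op_rev:
  "factors (\<lambda>f. face_op n \<gamma> (\<lambda>w. f (rev w))) ks f w = factors (rev_face_op n \<gamma>) ks (\<lambda>w. f (rev w)) (rev w)"
  by (induction ks arbitrary: w) (simp_all add: rev_face_op_def)

lemma B_family_carrier: "B_family n \<gamma> \<in> carrier (sym_group_algebra n)"
  by (simp add: sym_group_algebra_def carrier_sym_group_eq B_family_def B_comp_eq)

lemma basis_elt_carrier: "u permutes {1..n} \<Longrightarrow> basis_elt u \<in> carrier (sym_group_algebra n)"
  by (auto simp: sym_group_algebra_def carrier_sym_group_eq basis_elt_def)

theorem theorem10p2:
  fixes n :: nat
    and \<gamma> :: "nat list \<Rightarrow> real"
    and S :: "real set"
    and \<iota> :: "real \<Rightarrow> 'k::{comm_ring_1, linordered_ring}"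
    and ks :: "'k list"
  defines "A \<equiv> (sym_group_algebra n :: ((nat \<Rightarrow> nat) \<Rightarrow> 'k) ring)"
    and "w0 \<equiv> (basis_elt (longest_perm n) :: (nat \<Rightarrow> nat) \<Rightarrow> 'k)"
    and "B\<gamma> \<equiv> B_family n (\<lambda>\<alpha>. \<iota> (\<gamma> \<alpha>))"
    and "nt\<gamma> \<equiv> nt_family n (\<lambda>\<alpha>. \<iota> (\<gamma> \<alpha>))"
  assumes nonneg: "\<And>\<alpha>. \<alpha> \<in> compositions n \<Longrightarrow> 0 \<le> \<gamma> \<alpha>"
    and embedding: "real_subring_embedding S \<iota>"
    and contained: "\<And>\<alpha>. \<alpha> \<in> compositions n \<Longrightarrow> \<gamma> \<alpha> \<in> S"
    and ks: "distinct ks" "set ks = nt\<gamma> ` set_compositions n"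
  shows "list_prod A (map (\<lambda>k. w0 \<otimes>\<^bsub>A\<^esub> B\<gamma> \<ominus>\<^bsub>A\<^esub> scalar_elt n k) ks) = \<zero>\<^bsub>A\<^esub>
       \<and> list_prod A (map (\<lambda>k. B\<gamma> \<otimes>\<^bsub>A\<^esub> w0 \<ominus>\<^bsub>A\<^esub> scalar_elt n k) ks) = \<zero>\<^bsub>A\<^esub>"
proof -
  let ?\<gamma> = "\<lambda>\<alpha>. \<iota> (\<gamma> \<alpha>)"
  interpret A: ring "sym_group_algebra n :: ((nat \<Rightarrow> nat) \<Rightarrow> 'k) ring"
    by (rule ring_sym_group_algebra)
  \<comment> \<open>Zero arises as \<open>x - x\<close>. Since \<iota> is given as strictly monotone
    on \<open>S\<close>, coefficients equal to zero are treated separately below.\<close>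
  have zero: "0 \<in> S" "\<iota> 0 = 0"
    using embedding unfolding real_subring_embedding_def by (metis diff_self)+
  interpret weighted_faces n ?\<gamma>
  proof
    fix \<alpha>
    assume \<alpha>: "\<alpha> \<in> compositions n"
    have "\<iota> 0 < \<iota> (\<gamma> \<alpha>)" if "0 < \<gamma> \<alpha>"
      using embedding zero(1) contained[OF \<alpha>] that unfolding real_subring_embedding_def by blast
    then show "0 \<le> \<iota> (\<gamma> \<alpha>)"
      using nonneg[OF \<alpha>] zero(2) by (cases "\<gamma> \<alpha> = 0") auto
  qed
  have car: "w0 \<in> carrier (sym_group_algebra n)" "B\<gamma> \<in> carrier (sym_group_algebra n)"
    unfolding w0_def B\<gamma>_def by (rule basis_elt_carrier[OF longest_perm_permutes] B_family_carrier)+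
  have van: "factors (rev_face_op n ?\<gamma>) ks f w = 0" if "distinct w" "set w = {1..n}" for f w
    using ks(2) that by (intro factors_eq_zero) (simp_all add: nt\<gamma>_def)
  note id = one_line_permutes[OF permutes_id, of n]
  have "represents n (w0 \<otimes>\<^bsub>sym_group_algebra n\<^esub> B\<gamma>) (rev_face_op n ?\<gamma>)"
    using represents_mult[OF represents_longest_perm represents_B_family, of n ?\<gamma>]
    unfolding w0_def B\<gamma>_def rev_face_op_def[abs_def] .
  from represents_zero[OF represents_list_prod[OF this] list_prod_carrier, of ks]
  have "list_prod A (map (\<lambda>k. w0 \<otimes>\<^bsub>A\<^esub> B\<gamma> \<ominus>\<^bsub>A\<^esub> scalar_elt n k) ks) = \<zero>\<^bsub>A\<^esub>"
    unfolding A_def using car van[OF id] by blast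
  moreover have "represents n (B\<gamma> \<otimes>\<^bsub>sym_group_algebra n\<^esub> w0) (\<lambda>f. face_op n ?\<gamma> (\<lambda>w. f (rev w)))"
    using represents_mult[OF represents_B_family represents_longest_perm, of n ?\<gamma>]
    unfolding w0_def B\<gamma>_def .
  \<comment> \<open>Conjugation moves the evaluation to the reversed identity word, again an
    arrangement of \<open>1..n\<close>.\<close>
  from represents_zero[OF represents_list_prod[OF this] list_prod_carrier, of ks]
  have "list_prod A (map (\<lambda>k. B\<gamma> \<otimes>\<^bsub>A\<^esub> w0 \<ominus>\<^bsub>A\<^esub> scalar_elt n k) ks) = \<zero>\<^bsub>A\<^esub>"
    unfolding A_def using car van[of "rev (one_line n id)"] id by (simp add: factors_face_op_rev)
  ultimately show ?thesis ..
qed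

end
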